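(* Let $f:[0,1]\to[0,1]$ be a continuous map such that $\bigcap_{i=0}^\infty f^i([0,1])$ is not a singleton. If $f$ is $C^\infty$ smooth, then $$\Lambda(f)=\exp h(f),$$ where $h(f)$ denotes the topological entropy of $f$.
   Context: For a continuous map $f:[0,1]\to[0,1]$, $\Lambda(f)$ is the infimum of all real $\lambda$ such that for some homeomorphism $\psi:[0,1]\to[0,1]$ the map $g=\psi\circ f\circ\psi^{-1}$ has Lipschitz constant $\lambda$, i.e. $|g(x)-g(y)|\le\lambda|x-y|$ for all $x,y\in[0,1]$ (the infimum of the empty set is $\infty$). *)

theory Defs
  imports "HOL-Analysis.Analysis"
begin

text \<open>On a closed interval, \<^term>\<open>at x within S\<close> yields one-sided derivatives at the endpoints.\<close>

primrec C_k_on :: "nat \<Rightarrow> (real \<Rightarrow> real) \<Rightarrow> real set \<Rightarrow> bool" where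
  "C_k_on 0 f S \<longleftrightarrow> continuous_on S f"
| "C_k_on (Suc k) f S \<longleftrightarrow>
    (\<exists>f'. (\<forall>x\<in>S. (f has_real_derivative f' x) (at x within S)) \<and> C_k_on k f' S)"

definition C_infinity_on :: "(real \<Rightarrow> real) \<Rightarrow> real set \<Rightarrow> bool" where
  "C_infinity_on f S \<longleftrightarrow> (\<forall>k. C_k_on k f S)"

text \<open>The set is a subset of the extended reals, so its infimum is \<open>\<infinity>\<close> when it is empty.\<close>

definition Lip_inf :: "(real \<Rightarrow> real) \<Rightarrow> ereal" where
  "Lip_inf f = Inf {ereal L | (L :: real) (\<psi> :: real \<Rightarrow> real) (\<psi>' :: real \<Rightarrow> real).
     homeomorphism {0..1} {0..1} \<psi> \<psi>' \<and> L-lipschitz_on {0..1} (\<psi> \<circ> f \<circ> \<psi>')}"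

definition dyn_separated ::
  "('a::metric_space \<Rightarrow> 'a) \<Rightarrow> nat \<Rightarrow> real \<Rightarrow> 'a set \<Rightarrow> bool" where
  "dyn_separated f n \<epsilon> E \<longleftrightarrow>
    (\<forall>x\<in>E. \<forall>y\<in>E. x \<noteq> y \<longrightarrow> (\<exists>k<n. \<epsilon> < dist ((f ^^ k) x) ((f ^^ k) y)))"

text \<open>
  Bowen's definition of the topological entropy of a continuous self-map of a nonempty compact
  metric space \<open>X\<close>. The inner supremum is \<open>1/n\<close> times the logarithm of the maximal cardinality of an
  \<open>(n, \<epsilon>)\<close>-separated subset of \<open>X\<close>; since the upper limit grows as \<open>\<epsilon>\<close> decreases to \<open>0\<close>,
  its limit is the outer supremum.
\<close>

definition topological_entropy :: "'a::metric_space set \<Rightarrow> ('a \<Rightarrow> 'a) \<Rightarrow> ereal" where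
  "topological_entropy X f =
    (SUP \<epsilon>\<in>{0<..}. limsup (\<lambda>n.
       SUP E\<in>{E. E \<subseteq> X \<and> finite E \<and> E \<noteq> {} \<and> dyn_separated f n \<epsilon> E}.
         ereal (ln (real (card E)) / real n)))"

definition ereal_exp :: "ereal \<Rightarrow> ereal" where
  "ereal_exp x = (case x of ereal r \<Rightarrow> ereal (exp r) | PInfty \<Rightarrow> \<infinity> | MInfty \<Rightarrow> 0)"

end

theory Submission
  imports Defs
begin

text \<open>
  A map with a conjugate of Lipschitz constant \<open>L < 1\<close> has a one-point attractor, and if \<open>L \<ge> 1\<close>
  the entropy is at most \<open>ln L\<close>, since \<open>(n, \<epsilon>)\<close>-separated points are at distance at least a
  constant times \<open>L\<close> to the power \<open>-n\<close> after conjugation.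

  Conversely, for \<open>\<mu> > exp h(f)\<close> let \<open>\<psi> x\<close> be the sum over \<open>n\<close> of the variation of \<open>f ^^ n\<close> on
  \<open>{0..x}\<close>, divided by \<open>\<mu> ^ n\<close>. After normalisation \<open>\<psi>\<close> conjugates \<open>f\<close> to a \<open>\<mu>\<close>-Lipschitz map,
  provided that the series converges, that is, provided that the variation of \<open>f ^^ n\<close> grows at
  rate at most \<open>exp h(f)\<close>. For this one-dimensional case of Yomdin's theorem let \<open>g\<close> be an iterate of
  \<open>f\<close> and \<open>\<theta> = 2 / k\<close>. Smoothness of order \<open>k + 1\<close> forces \<open>g'\<close> to be small where it
  changes sign often, so that on short intervals \<open>J\<close> the integral of \<open>\<Phi> (g x) * \<bar>g' x\<bar> powr (1 + \<theta>)\<close>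
  is at most \<open>2 ^ k * (sup \<bar>g'\<bar>) powr \<theta>\<close> times the integral of \<open>\<Phi>\<close>. Iterating this along an orbit bounds
  the variation of \<open>g ^^ n\<close> on a Bowen ball, and the entropy bounds the number of Bowen balls. The
  losses \<open>2 ^ k\<close> and \<open>\<theta>\<close> disappear when first \<open>k\<close> and then the order of the iterate is taken large.
\<close>

subsection \<open>Smooth functions and sign changes\<close>

lemma C_k_on_imp_continuous: "C_k_on k f S \<Longrightarrow> continuous_on S f"
  by (cases k) (auto simp: continuous_on_eq_continuous_within intro: DERIV_continuous)

lemma C_k_on_Suc_imp: "C_k_on (Suc k) f S \<Longrightarrow> C_k_on k f S"
proof (induction k arbitrary: f)
  case 0
  then show ?case using C_k_on_imp_continuous[of "Suc 0"] by simp
next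
  case (Suc k)
  then show ?case by (metis C_k_on.simps(2))
qed

lemma C_k_on_cong:
  assumes "C_k_on k f S" "\<And>x. x \<in> S \<Longrightarrow> f x = g x"
  shows "C_k_on k g S"
proof (cases k)
  case 0
  then show ?thesis using assms continuous_on_cong[of S S f g] by simp
next
  case (Suc n)
  with assms obtain f' where f': "\<forall>x\<in>S. (f has_real_derivative f' x) (at x within S)" "C_k_on n f' S"
    by auto
  have "(g has_real_derivative f' x) (at x within S)" if "x \<in> S" for x
    using has_field_derivative_transform_within[of f "f' x" x S 1 g] f'(1) that assms(2) by simp
  then show ?thesis using f' Suc by auto
qed

lemma C_k_on_const: "C_k_on k (\<lambda>_. c) S"
proof (induction k arbitrary: c)
  case (Suc k)
  show ?case by (auto intro!: exI[of _ "\<lambda>_. 0"] Suc)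
qed simp

lemma C_k_on_add: "C_k_on k f S \<Longrightarrow> C_k_on k g S \<Longrightarrow> C_k_on k (\<lambda>x. f x + g x) S"
proof (induction k arbitrary: f g)
  case 0
  then show ?case by (simp add: continuous_on_add)
next
  case (Suc k)
  then obtain f' g' where
    "\<forall>x\<in>S. (f has_real_derivative f' x) (at x within S)" "C_k_on k f' S"
    "\<forall>x\<in>S. (g has_real_derivative g' x) (at x within S)" "C_k_on k g' S"
    by auto
  then show ?case using Suc.IH
    by (auto intro!: exI[of _ "\<lambda>x. f' x + g' x"] derivative_intros)
qed

lemma C_k_on_mult: "C_k_on k f S \<Longrightarrow> C_k_on k g S \<Longrightarrow> C_k_on k (\<lambda>x. f x * g x) S"
proof (induction k arbitrary: f g)
  case 0
  then show ?case by (simp add: continuous_on_mult)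
next
  case (Suc k)
  then obtain f' g' where *:
    "\<forall>x\<in>S. (f has_real_derivative f' x) (at x within S)" "C_k_on k f' S"
    "\<forall>x\<in>S. (g has_real_derivative g' x) (at x within S)" "C_k_on k g' S"
    by auto
  have "C_k_on k f S" "C_k_on k g S"
    using Suc.prems by (auto intro: C_k_on_Suc_imp simp del: C_k_on.simps)
  then have "C_k_on k (\<lambda>x. f' x * g x + g' x * f x) S"
    using * Suc.IH by (intro C_k_on_add) auto
  moreover have "\<forall>x\<in>S. ((\<lambda>x. f x * g x) has_real_derivative f' x * g x + g' x * f x) (at x within S)"
    using * by (auto intro!: derivative_eq_intros)
  ultimately show ?case by (auto intro: exI[of _ "\<lambda>x. f' x * g x + g' x * f x"])
qed

lemma C_k_on_compose:
  "C_k_on k f T \<Longrightarrow> C_k_on k g S \<Longrightarrow> g ` S \<subseteq> T \<Longrightarrow> C_k_on k (\<lambda>x. f (g x)) S"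
proof (induction k arbitrary: f)
  case 0
  then show ?case using continuous_on_compose2 by auto
next
  case (Suc k)
  then obtain f' g' where *:
    "\<forall>x\<in>T. (f has_real_derivative f' x) (at x within T)" "C_k_on k f' T"
    "\<forall>x\<in>S. (g has_real_derivative g' x) (at x within S)" "C_k_on k g' S"
    by auto
  have "C_k_on k g S"
    using Suc.prems by (auto intro: C_k_on_Suc_imp simp del: C_k_on.simps)
  then have "C_k_on k (\<lambda>x. f' (g x) * g' x) S"
    using * Suc by (intro C_k_on_mult) auto
  moreover have "((\<lambda>x. f (g x)) has_real_derivative f' (g x) * g' x) (at x within S)" if "x \<in> S" for x
  proof -
    have "(f has_real_derivative f' (g x)) (at (g x) within g ` S)"
      using * that Suc.prems(3) by (metis DERIV_subset image_subset_iff)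
    from DERIV_image_chain[OF this] show ?thesis using * that by (simp add: o_def)
  qed
  ultimately show ?case by (auto intro: exI[of _ "\<lambda>x. f' (g x) * g' x"])
qed

text \<open>For each order \<open>C_k_on\<close> may provide a different derivative function. On a
  nondegenerate interval derivatives are unique, so all of them agree with the given
  \<open>f'\<close> there.\<close>

lemma C_infinity_on_derivative:
  fixes f' :: "real \<Rightarrow> real"
  assumes "C_infinity_on f {a..b}" "a < b"
    and f': "\<And>x. x \<in> {a..b} \<Longrightarrow> (f has_real_derivative f' x) (at x within {a..b})"
  shows "C_k_on k f' {a..b}"
proof -
  obtain g where g: "\<forall>x\<in>{a..b}. (f has_real_derivative g x) (at x within {a..b})" "C_k_on k g {a..b}"
    using assms(1) by (metis C_infinity_on_def C_k_on.simps(2))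
  have "g x = f' x" if "x \<in> {a..b}" for x
    using vector_derivative_unique_within_closed_interval[of a b x f "g x" "f' x"] g f' that \<open>a < b\<close>
    by (auto simp: has_real_derivative_iff_has_vector_derivative)
  then show ?thesis using C_k_on_cong[OF g(2)] by auto
qed

text \<open>A cut of \<open>{a..b}\<close> into finitely many intervals on each of which
  \<open>h\<close> has a weak sign. Since \<open>const_sign\<close> accepts every \<open>n\<close>
  from 1 on, \<open>n\<close> is only an upper bound for the number of pieces; the inductive form
  lets estimates be proved on one piece and added up.\<close>

inductive sign_split :: "(real \<Rightarrow> real) \<Rightarrow> nat \<Rightarrow> real \<Rightarrow> real \<Rightarrow> bool" for h where
  const_sign: "1 \<le> n \<Longrightarrow> a \<le> b \<Longrightarrow> (\<forall>x\<in>{a..b}. 0 \<le> h x) \<or> (\<forall>x\<in>{a..b}. h x \<le> 0) \<Longrightarrow>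
    sign_split h n a b"
| join: "sign_split h m a c \<Longrightarrow> sign_split h n c b \<Longrightarrow> sign_split h (m + n) a b"

lemma sign_split_le: "sign_split h n a b \<Longrightarrow> a \<le> b"
  by (induction rule: sign_split.induct) auto

lemma no_zero_imp_const_sign:
  fixes h :: "real \<Rightarrow> real"
  assumes "continuous_on {a..b} h" "\<not> (\<exists>z\<in>{a..b}. h z = 0)"
  shows "(\<forall>x\<in>{a..b}. 0 \<le> h x) \<or> (\<forall>x\<in>{a..b}. h x \<le> 0)"
proof (rule ccontr)
  assume "\<not> ?thesis"
  then obtain x y where xy: "x \<in> {a..b}" "y \<in> {a..b}" "h x \<le> 0" "0 \<le> h y" by force
  have "is_interval (h ` {a..b})"
    using assms by (simp add: is_interval_connected_1 connected_continuous_image)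
  then have "0 \<in> h ` {a..b}" unfolding is_interval_1 using xy by blast
  then show False using assms by force
qed

lemma real_mvt_within:
  fixes h h' :: "real \<Rightarrow> real"
  assumes h': "\<And>x. x \<in> S \<Longrightarrow> (h has_real_derivative h' x) (at x within S)"
    and "{a..b} \<subseteq> S" "a \<le> b"
  shows "\<exists>x\<in>{a..b}. h b - h a = h' x * (b - a)"
proof (rule mvt_very_simple[OF \<open>a \<le> b\<close>])
  fix x assume "a \<le> x" "x \<le> b"
  then show "(h has_derivative (\<lambda>d. h' x * d)) (at x within {a..b})"
    using h'[of x] assms(2) DERIV_subset[of h "h' x" x S "{a..b}"]
    by (auto simp: has_field_derivative_def)
qed

text \<open>A function with derivative of constant sign changes its sign at most once.\<close>

lemma sign_split_antiderivative:
  assumes "sign_split h' n a b"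
    and h': "\<And>x. x \<in> S \<Longrightarrow> (h has_real_derivative h' x) (at x within S)"
    and "{a..b} \<subseteq> S"
  shows "sign_split h (2 * n) a b"
  using assms(1,3)
proof (induction rule: sign_split.induct)
  case (const_sign n a b)
  have cont: "continuous_on {a..b} h"
    using h' const_sign.prems
    by (meson DERIV_continuous continuous_on_eq_continuous_within continuous_on_subset)
  have mvt: "\<exists>z\<in>{a..b}. h y - h x = h' z * (y - x)" if "a \<le> x" "x \<le> y" "y \<le> b" for x y
  proof -
    have "\<exists>z\<in>{x..y}. h y - h x = h' z * (y - x)"
      by (rule real_mvt_within[OF h']) (use const_sign.prems that in auto)
    then show ?thesis using that by (meson atLeastAtMost_iff order_trans)
  qed
  have mono: "(\<forall>x y. a \<le> x \<and> x \<le> y \<and> y \<le> b \<longrightarrow> h x \<le> h y) \<or>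
              (\<forall>x y. a \<le> x \<and> x \<le> y \<and> y \<le> b \<longrightarrow> h y \<le> h x)"
    using const_sign.hyps(3)
  proof
    assume pos: "\<forall>x\<in>{a..b}. 0 \<le> h' x"
    have "h x \<le> h y" if xy: "a \<le> x" "x \<le> y" "y \<le> b" for x y
    proof -
      from mvt[OF xy] obtain z where "z \<in> {a..b}" "h y - h x = h' z * (y - x)" by blast
      moreover have "0 \<le> h' z * (y - x)" using pos \<open>z \<in> _\<close> xy by (intro mult_nonneg_nonneg) auto
      ultimately show ?thesis by linarith
    qed
    then show ?thesis by blast
  next
    assume neg: "\<forall>x\<in>{a..b}. h' x \<le> 0"
    have "h y \<le> h x" if xy: "a \<le> x" "x \<le> y" "y \<le> b" for x y
    proof -
      from mvt[OF xy] obtain z where "z \<in> {a..b}" "h y - h x = h' z * (y - x)" by blast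
      moreover have "h' z * (y - x) \<le> 0" using neg \<open>z \<in> _\<close> xy by (intro mult_nonpos_nonneg) auto
      ultimately show ?thesis by linarith
    qed
    then show ?thesis by blast
  qed
  define P where "P S \<longleftrightarrow> (\<forall>x\<in>S. 0 \<le> h x) \<or> (\<forall>x\<in>S. h x \<le> 0)" for S
  \<comment> \<open>The cut goes at a zero of \<open>h\<close>; if there is none, \<open>h\<close>
    has constant sign and any point serves.\<close>
  have "\<exists>c\<in>{a..b}. h c = 0 \<or> P {a..b}"
  proof (cases "\<exists>c\<in>{a..b}. h c = 0")
    case False
    then have "P {a..b}" unfolding P_def using no_zero_imp_const_sign[OF cont] by blast
    then show ?thesis using const_sign.hyps(2) by auto
  qed blast
  then obtain c where c: "a \<le> c" "c \<le> b" "h c = 0 \<or> P {a..b}" by auto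
  have "P {a..c} \<and> P {c..b}"
  proof (cases "P {a..b}")
    case True
    then show ?thesis using c(1,2) unfolding P_def by auto
  next
    case False
    with c have "h c = 0" by blast
    from mono show ?thesis
    proof
      assume "\<forall>x y. a \<le> x \<and> x \<le> y \<and> y \<le> b \<longrightarrow> h x \<le> h y"
      then have "\<forall>x\<in>{a..c}. h x \<le> h c" "\<forall>x\<in>{c..b}. h c \<le> h x" using c(1,2) by auto
      then show ?thesis using \<open>h c = 0\<close> unfolding P_def by auto
    next
      assume "\<forall>x y. a \<le> x \<and> x \<le> y \<and> y \<le> b \<longrightarrow> h y \<le> h x"
      then have "\<forall>x\<in>{a..c}. h c \<le> h x" "\<forall>x\<in>{c..b}. h x \<le> h c" using c(1,2) by auto
      then show ?thesis using \<open>h c = 0\<close> unfolding P_def by auto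
    qed
  qed
  then have "sign_split h (n + n) a b"
    using const_sign.hyps c unfolding P_def by (intro sign_split.join[of h n a c n b] sign_split.const_sign) auto
  then show ?case by (simp add: mult_2)
next
  case (join m a c n b)
  note sign_split_le[OF join.hyps(1)] sign_split_le[OF join.hyps(2)]
  then have "{a..c} \<subseteq> S" "{c..b} \<subseteq> S" using join.prems by auto
  then have "sign_split h (2 * m + 2 * n) a b"
    by (intro sign_split.join[of h "2*m" a c "2*n" b] join.IH)
  then show ?case by (simp add: algebra_simps)
qed

text \<open>Either \<open>h\<close> or one of its derivatives vanishes nowhere, and integrating that derivative back
  at most doubles the number of sign changes at each step; or all of them have a zero, and the mean
  value theorem makes \<open>h\<close> small.\<close>

lemma C_k_on_small_or_sign_split:
  assumes "C_k_on k h {A..B}"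
  shows "\<exists>Q\<ge>0. \<forall>a b. A \<le> a \<and> a \<le> b \<and> b \<le> B \<longrightarrow>
    (\<forall>x\<in>{a..b}. \<bar>h x\<bar> \<le> Q * (b - a) ^ k) \<or> sign_split h (2 ^ k) a b"
  using assms
proof (induction k arbitrary: h)
  case 0
  then have "bounded (h ` {A..B})" by (simp add: compact_continuous_image compact_imp_bounded)
  then obtain Q where Q: "\<forall>x\<in>{A..B}. \<bar>h x\<bar> \<le> Q" by (auto simp: bounded_iff)
  then have "\<bar>h x\<bar> \<le> max 0 Q" if "x \<in> {A..B}" for x using that by fastforce
  then show ?case by (intro exI[of _ "max 0 Q"]) auto
next
  case (Suc k)
  then obtain h' where h': "\<forall>x\<in>{A..B}. (h has_real_derivative h' x) (at x within {A..B})"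
    and "C_k_on k h' {A..B}" by auto
  with Suc.IH obtain Q where "Q \<ge> 0" and Q: "\<And>a b. A \<le> a \<Longrightarrow> a \<le> b \<Longrightarrow> b \<le> B \<Longrightarrow>
    (\<forall>x\<in>{a..b}. \<bar>h' x\<bar> \<le> Q * (b - a) ^ k) \<or> sign_split h' (2 ^ k) a b" by metis
  have cont: "continuous_on {A..B} h" using Suc.prems C_k_on_imp_continuous by blast
  have "(\<forall>x\<in>{a..b}. \<bar>h x\<bar> \<le> Q * (b - a) ^ Suc k) \<or> sign_split h (2 ^ Suc k) a b"
    if ab: "A \<le> a" "a \<le> b" "b \<le> B" for a b
  proof (cases "sign_split h' (2 ^ k) a b")
    case True
    then show ?thesis using sign_split_antiderivative[OF True, of "{A..B}" h] h' ab by auto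
  next
    case False
    with Q ab have small: "\<And>x. x \<in> {a..b} \<Longrightarrow> \<bar>h' x\<bar> \<le> Q * (b - a) ^ k" by blast
    have cont': "continuous_on {a..b} h" using cont by (rule continuous_on_subset) (use ab in auto)
    show ?thesis
    proof (cases "\<exists>z\<in>{a..b}. h z = 0")
      case True
      then obtain z where z: "z \<in> {a..b}" "h z = 0" by blast
      have "\<bar>h x\<bar> \<le> Q * (b - a) ^ Suc k" if x: "x \<in> {a..b}" for x
      proof -
        have "\<exists>w\<in>{min x z..max x z}. h (max x z) - h (min x z) = h' w * (max x z - min x z)"
          by (rule real_mvt_within[of "{A..B}"]) (use h' z x ab in auto)
        then obtain w where w: "w \<in> {min x z..max x z}" "h (max x z) - h (min x z) = h' w * (max x z - min x z)"
          by blast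
        then have "w \<in> {a..b}" using z x by auto
        have "\<bar>h x\<bar> = \<bar>h (max x z) - h (min x z)\<bar>" using z by (auto simp: max_def min_def)
        also have "\<dots> = \<bar>h' w\<bar> * \<bar>max x z - min x z\<bar>" using w by (simp add: abs_mult)
        also have "\<dots> \<le> (Q * (b - a) ^ k) * (b - a)"
          using small[OF \<open>w \<in> {a..b}\<close>] z x ab \<open>Q \<ge> 0\<close> by (intro mult_mono) auto
        finally show ?thesis by (simp add: mult_ac)
      qed
      then show ?thesis by blast
    next
      case False
      with no_zero_imp_const_sign[OF cont']
      have "(\<forall>x\<in>{a..b}. 0 \<le> h x) \<or> (\<forall>x\<in>{a..b}. h x \<le> 0)" by blast
      then show ?thesis using ab by (auto intro: sign_split.const_sign)
    qed
  qed
  then show ?case using \<open>Q \<ge> 0\<close> by blast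
qed

subsection \<open>The transfer estimate\<close>

text \<open>Integrating \<open>g'\<close> prolongs \<open>g\<close> beyond both endpoints. This
  turns the one-sided derivatives there into the two-sided ones used in the change of
  variables.\<close>

lemma C1_extension:
  fixes g g' :: "real \<Rightarrow> real"
  assumes deriv: "\<And>x. x \<in> {A..B} \<Longrightarrow> (g has_real_derivative g' x) (at x within {A..B})"
    and cont: "continuous_on UNIV g'"
  obtains G where "\<And>x. x \<in> {A..B} \<Longrightarrow> G x = g x"
    "\<And>x. x \<in> {A..B} \<Longrightarrow> (G has_real_derivative g' x) (at x)"
proof -
  \<comment> \<open>Starting at \<open>A - 1\<close> keeps \<open>{A..B}\<close> in the interior of
    the domain of integration, so that \<open>J\<close> has a two-sided derivative even at
    \<open>A\<close>.\<close>
  define J where "J x = integral {A-1..x} g'" for x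
  define G where "G x = g A - J A + J x" for x
  have int: "g' integrable_on {a..b}" for a b
    by (intro integrable_continuous_real continuous_on_subset[OF cont]) simp
  have "G x = g x" if x: "x \<in> {A..B}" for x
  proof -
    have "(g' has_integral g x - g A) {A..x}"
    proof (rule fundamental_theorem_of_calculus)
      fix y assume y: "y \<in> {A..x}"
      have "{A..x} \<subseteq> {A..B}" "y \<in> {A..B}" using x y by auto
      then have "(g has_real_derivative g' y) (at y within {A..x})"
        by (metis DERIV_subset deriv)
      then show "(g has_vector_derivative g' y) (at y within {A..x})"
        by (simp add: has_real_derivative_iff_has_vector_derivative)
    qed (use x in auto)
    then have "integral {A..x} g' = g x - g A" by (rule integral_unique)
    moreover have "J A + integral {A..x} g' = J x"
      unfolding J_def using x by (intro Henstock_Kurzweil_Integration.integral_combine int) auto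
    ultimately show "G x = g x" by (simp add: G_def)
  qed
  moreover have "(G has_real_derivative g' x) (at x)" if x: "x \<in> {A..B}" for x
  proof -
    have "(J has_real_derivative g' x) (at x within {A-1..B+1})"
      unfolding J_def using x
      by (intro integral_has_real_derivative continuous_on_subset[OF cont]) auto
    moreover have "at x within {A-1..B+1} = at x"
      using x by (intro at_within_interior) auto
    ultimately show ?thesis
      unfolding G_def by (auto intro!: derivative_eq_intros)
  qed
  ultimately show thesis using that by blast
qed

lemma nn_integral_substitution_nonneg:
  fixes g g' \<Phi> :: "real \<Rightarrow> real"
  assumes deriv: "\<And>x. x \<in> {A..B} \<Longrightarrow> (g has_real_derivative g' x) (at x within {A..B})"
    and cont: "continuous_on UNIV g'"
    and "A \<le> a" "a \<le> b" "b \<le> B"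
    and [measurable]: "\<Phi> \<in> borel_measurable borel"
    and sign: "\<And>x. x \<in> {a..b} \<Longrightarrow> 0 \<le> g' x"
  shows "(\<integral>\<^sup>+x. ennreal (\<Phi> (g x) * g' x * indicator {a..b} x) \<partial>lborel)
       = (\<integral>\<^sup>+y. ennreal (\<Phi> y * indicator {g a..g b} y) \<partial>lborel)"
proof -
  obtain G where G: "\<And>x. x \<in> {A..B} \<Longrightarrow> G x = g x"
    "\<And>x. x \<in> {A..B} \<Longrightarrow> (G has_real_derivative g' x) (at x)"
    using C1_extension[OF deriv cont] by blast
  have "(\<integral>\<^sup>+y. \<Phi> y * indicator {G a..G b} y \<partial>lborel)
      = (\<integral>\<^sup>+x. \<Phi> (G x) * g' x * indicator {a..b} x \<partial>lborel)"
    using assms G(2)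
    by (intro nn_integral_substitution)
      (auto simp: set_borel_measurable_def intro!: continuous_on_subset[OF cont])
  moreover have "(\<integral>\<^sup>+x. \<Phi> (G x) * g' x * indicator {a..b} x \<partial>lborel)
    = (\<integral>\<^sup>+x. \<Phi> (g x) * g' x * indicator {a..b} x \<partial>lborel)"
    using assms by (intro nn_integral_cong) (auto simp: indicator_def G(1))
  ultimately show ?thesis using G(1) assms by simp
qed

text \<open>Both functions are continuous on the whole line, which makes them Borel without
  restriction. Outside the unit interval \<open>g'\<close> need not be the derivative of
  \<open>g\<close>; a map of the interval is made to fit by extending it and its derivative by
  constants.\<close>

locale unit_interval_C1_map =
  fixes g g' :: "real \<Rightarrow> real"
  assumes cont: "continuous_on UNIV g"
    and cont': "continuous_on UNIV g'"
    and range: "\<And>x. g x \<in> {0..1}"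
    and deriv: "\<And>x. x \<in> {0..1} \<Longrightarrow> (g has_real_derivative g' x) (at x within {0..1})"
begin

lemma borel [measurable]: "g \<in> borel_measurable borel" "g' \<in> borel_measurable borel"
  using cont cont' by (auto intro: borel_measurable_continuous_onI)

text \<open>Here \<open>g\<close> is monotone, so substitution yields the integral of \<Phi> between
  the two endpoint values, which lie in the unit interval by \<open>range\<close>. The decreasing
  case is the increasing one for \<open>- g\<close> and the reflected weight.\<close>

lemma nn_integral_const_sign:
  fixes \<Phi> :: "real \<Rightarrow> real"
  assumes ab: "0 \<le> a" "a \<le> b" "b \<le> 1"
    and [measurable]: "\<Phi> \<in> borel_measurable borel"
    and nonneg: "\<And>x. 0 \<le> \<Phi> x"
    and sign: "(\<forall>x\<in>{a..b}. 0 \<le> g' x) \<or> (\<forall>x\<in>{a..b}. g' x \<le> 0)"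
  shows "(\<integral>\<^sup>+x. ennreal (\<Phi> (g x) * \<bar>g' x\<bar> * indicator {a..b} x) \<partial>lborel)
       \<le> (\<integral>\<^sup>+y. ennreal (\<Phi> y * indicator {0..1} y) \<partial>lborel)"
  using sign
proof
  assume pos: "\<forall>x\<in>{a..b}. 0 \<le> g' x"
  have "(\<integral>\<^sup>+x. ennreal (\<Phi> (g x) * \<bar>g' x\<bar> * indicator {a..b} x) \<partial>lborel)
      = (\<integral>\<^sup>+x. ennreal (\<Phi> (g x) * g' x * indicator {a..b} x) \<partial>lborel)"
    using pos by (intro nn_integral_cong) (auto simp: indicator_def)
  also have "\<dots> = (\<integral>\<^sup>+y. ennreal (\<Phi> y * indicator {g a..g b} y) \<partial>lborel)"
    using ab pos by (intro nn_integral_substitution_nonneg[OF deriv cont']) auto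
  also have "\<dots> \<le> (\<integral>\<^sup>+y. ennreal (\<Phi> y * indicator {0..1} y) \<partial>lborel)"
    using range[of a] range[of b] nonneg
    by (intro nn_integral_mono ennreal_leI mult_left_mono) (auto simp: indicator_def)
  finally show ?thesis .
next
  assume neg: "\<forall>x\<in>{a..b}. g' x \<le> 0"
  have "(\<integral>\<^sup>+x. ennreal (\<Phi> (g x) * \<bar>g' x\<bar> * indicator {a..b} x) \<partial>lborel)
      = (\<integral>\<^sup>+x. ennreal (\<Phi> (- (- g x)) * (- g' x) * indicator {a..b} x) \<partial>lborel)"
    using neg by (intro nn_integral_cong) (auto simp: indicator_def)
  also have "\<dots> = (\<integral>\<^sup>+y. ennreal (\<Phi> (- y) * indicator {- g a..- g b} y) \<partial>lborel)"
    using ab neg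
    by (intro nn_integral_substitution_nonneg[where \<Phi> = "\<lambda>y. \<Phi> (- y)" and A = 0 and B = 1])
      (auto intro!: derivative_intros deriv continuous_intros cont')
  \<comment> \<open>The argument is written as an affine map, so that the affine substitution below
    undoes the reflection.\<close>
  also have "\<dots> \<le> (\<integral>\<^sup>+y. ennreal (\<Phi> (0 + (- 1) * y) * indicator {0..1} (0 + (- 1) * y)) \<partial>lborel)"
    using range[of a] range[of b] nonneg
    by (intro nn_integral_mono ennreal_leI) (auto simp: indicator_def)
  also have "\<dots> = (\<integral>\<^sup>+y. ennreal (\<Phi> y * indicator {0..1} y) \<partial>lborel)"
    by (subst nn_integral_real_affine[where c = "-1" and t = 0]) auto
  finally show ?thesis .
qed

text \<open>On each piece \<open>\<bar>g' x\<bar> powr (1 + \<theta>)\<close> is at most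
  \<open>s powr \<theta> * \<bar>g' x\<bar>\<close>, and the remaining factor
  \<open>\<bar>g' x\<bar>\<close> is absorbed by substitution. The bounds of the \<open>n\<close>
  pieces add up.\<close>

lemma nn_integral_sign_split:
  fixes \<Phi> :: "real \<Rightarrow> real"
  assumes "sign_split g' n a b" "0 \<le> a" "b \<le> 1"
    and [measurable]: "\<Phi> \<in> borel_measurable borel"
    and nonneg: "\<And>x. 0 \<le> \<Phi> x"
    and "0 \<le> \<theta>" "\<And>x. x \<in> {a..b} \<Longrightarrow> \<bar>g' x\<bar> \<le> s"
  shows "(\<integral>\<^sup>+x. ennreal (\<Phi> (g x) * \<bar>g' x\<bar> powr (1 + \<theta>) * indicator {a..b} x) \<partial>lborel)
       \<le> ennreal (real n * s powr \<theta>) * (\<integral>\<^sup>+y. ennreal (\<Phi> y * indicator {0..1} y) \<partial>lborel)"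
  using assms(1,2,3,7)
proof (induction rule: sign_split.induct)
  case (const_sign n a b)
  have le: "\<Phi> (g x) * \<bar>g' x\<bar> powr (1 + \<theta>) * indicator {a..b} x
    \<le> (real n * s powr \<theta>) * (\<Phi> (g x) * \<bar>g' x\<bar> * indicator {a..b} x)" for x
  proof (cases "x \<in> {a..b}")
    case True
    have "\<bar>g' x\<bar> powr (1 + \<theta>) = \<bar>g' x\<bar> powr \<theta> * \<bar>g' x\<bar>"
      by (simp add: powr_add)
    also have "\<dots> \<le> s powr \<theta> * \<bar>g' x\<bar>"
      using const_sign.prems(3)[OF True] \<open>0 \<le> \<theta>\<close> by (intro mult_right_mono powr_mono2) auto
    also have "\<dots> \<le> (real n * s powr \<theta>) * \<bar>g' x\<bar>"
      using const_sign.hyps(1) mult_right_mono[of 1 "real n" "s powr \<theta> * \<bar>g' x\<bar>"] by (simp add: mult_ac)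
    finally have "\<Phi> (g x) * \<bar>g' x\<bar> powr (1 + \<theta>) \<le> \<Phi> (g x) * ((real n * s powr \<theta>) * \<bar>g' x\<bar>)"
      by (rule mult_left_mono[OF _ nonneg])
    then show ?thesis using True by (simp add: mult_ac)
  qed simp
  have "(\<integral>\<^sup>+x. ennreal (\<Phi> (g x) * \<bar>g' x\<bar> powr (1 + \<theta>) * indicator {a..b} x) \<partial>lborel)
    \<le> (\<integral>\<^sup>+x. ennreal (real n * s powr \<theta>) * ennreal (\<Phi> (g x) * \<bar>g' x\<bar> * indicator {a..b} x) \<partial>lborel)"
    using le nonneg by (intro nn_integral_mono) (simp add: ennreal_mult'[symmetric] ennreal_leI)
  also have "\<dots> = ennreal (real n * s powr \<theta>)
      * (\<integral>\<^sup>+x. ennreal (\<Phi> (g x) * \<bar>g' x\<bar> * indicator {a..b} x) \<partial>lborel)"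
    by (intro nn_integral_cmult) simp
  also have "\<dots> \<le> ennreal (real n * s powr \<theta>) * (\<integral>\<^sup>+y. ennreal (\<Phi> y * indicator {0..1} y) \<partial>lborel)"
    using const_sign by (intro mult_left_mono nn_integral_const_sign nonneg) auto
  finally show ?case .
next
  case (join m a c n b)
  note ac = sign_split_le[OF join.hyps(1)] and cb = sign_split_le[OF join.hyps(2)]
  let ?F = "\<lambda>S x. \<Phi> (g x) * \<bar>g' x\<bar> powr (1 + \<theta>) * indicator S x"
  have "(\<integral>\<^sup>+x. ennreal (?F {a..b} x) \<partial>lborel)
    \<le> (\<integral>\<^sup>+x. ennreal (?F {a..c} x) + ennreal (?F {c..b} x) \<partial>lborel)"
    by (intro nn_integral_mono) (auto simp: indicator_def)
  also have "\<dots> = (\<integral>\<^sup>+x. ennreal (?F {a..c} x) \<partial>lborel) + (\<integral>\<^sup>+x. ennreal (?F {c..b} x) \<partial>lborel)"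
    by (intro nn_integral_add) simp_all
  also have "\<dots> \<le> ennreal (real m * s powr \<theta>) * (\<integral>\<^sup>+y. ennreal (\<Phi> y * indicator {0..1} y) \<partial>lborel)
      + ennreal (real n * s powr \<theta>) * (\<integral>\<^sup>+y. ennreal (\<Phi> y * indicator {0..1} y) \<partial>lborel)"
    using join ac cb by (intro add_mono join.IH) auto
  also have "\<dots> = ennreal (real (m + n) * s powr \<theta>) * (\<integral>\<^sup>+y. ennreal (\<Phi> y * indicator {0..1} y) \<partial>lborel)"
    by (simp add: distrib_right[symmetric] ennreal_plus[symmetric] del: ennreal_plus)
  finally show ?case .
qed

text \<open>Intervals on which \<open>g'\<close> oscillates are bisected repeatedly. With \<open>\<theta> = 2 / k\<close> the bound
  on \<open>\<bar>g'\<bar> powr \<theta>\<close> drops by a factor 4 whenever the number of intervals doubles.\<close>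

lemma nn_integral_bisect:
  fixes \<Phi> :: "real \<Rightarrow> real"
  assumes "1 \<le> k" "0 \<le> Q"
    and dich: "\<And>a b. 0 \<le> a \<Longrightarrow> a \<le> b \<Longrightarrow> b \<le> 1 \<Longrightarrow>
      (\<forall>x\<in>{a..b}. \<bar>g' x\<bar> \<le> Q * (b - a) ^ k) \<or> sign_split g' (2 ^ k) a b"
    and [measurable]: "\<Phi> \<in> borel_measurable borel"
    and nonneg: "\<And>x. 0 \<le> \<Phi> x" and bd: "\<And>x. \<Phi> x \<le> C"
    and \<theta>: "\<theta> = 2 / real k"
    and "0 \<le> a" "a \<le> b" "b \<le> 1" "0 \<le> \<sigma>"
    and "\<And>x. x \<in> {a..b} \<Longrightarrow> \<bar>g' x\<bar> \<le> \<sigma>" "2 ^ k * Q * (b - a) ^ k \<le> \<sigma>"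
  shows "(\<integral>\<^sup>+x. ennreal (\<Phi> (g x) * \<bar>g' x\<bar> powr (1 + \<theta>) * indicator {a..b} x) \<partial>lborel)
       \<le> ennreal (2 ^ k * \<sigma> powr \<theta>) * (\<integral>\<^sup>+y. ennreal (\<Phi> y * indicator {0..1} y) \<partial>lborel)
         + ennreal (C * \<sigma> powr (1 + \<theta>) / 2 ^ N)"
  using assms(8-)
proof (induction N arbitrary: a b \<sigma>)
  case 0
  have "0 \<le> C" using nonneg[of 0] bd[of 0] by linarith
  have \<theta>0: "0 \<le> \<theta>" using \<theta> by simp
  \<comment> \<open>At depth 0 a crude bound is enough: the integrand is at most
    \<open>C * \<sigma> powr (1 + \<theta>)\<close> and the interval has length at most 1.\<close>
  have "(\<integral>\<^sup>+x. ennreal (\<Phi> (g x) * \<bar>g' x\<bar> powr (1 + \<theta>) * indicator {a..b} x) \<partial>lborel)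
    \<le> (\<integral>\<^sup>+x. ennreal (C * \<sigma> powr (1 + \<theta>)) * indicator {a..b} x \<partial>lborel)"
  proof (intro nn_integral_mono)
    fix x
    show "ennreal (\<Phi> (g x) * \<bar>g' x\<bar> powr (1 + \<theta>) * indicator {a..b} x)
      \<le> ennreal (C * \<sigma> powr (1 + \<theta>)) * indicator {a..b} x"
      using 0 bd[of "g x"] nonneg[of "g x"] \<theta>0 \<open>0 \<le> C\<close>
      by (cases "x \<in> {a..b}") (auto intro!: ennreal_leI mult_mono powr_mono2)
  qed
  also have "\<dots> = ennreal (C * \<sigma> powr (1 + \<theta>)) * ennreal (b - a)"
    using 0 by (simp add: nn_integral_cmult_indicator)
  also have "\<dots> \<le> ennreal (C * \<sigma> powr (1 + \<theta>)) * 1"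
    using 0 by (intro mult_left_mono) auto
  also have "\<dots> \<le> ennreal (2 ^ k * \<sigma> powr \<theta>) * (\<integral>\<^sup>+y. ennreal (\<Phi> y * indicator {0..1} y) \<partial>lborel)
         + ennreal (C * \<sigma> powr (1 + \<theta>) / 2 ^ 0)" by simp
  finally show ?case .
next
  case (Suc N)
  have "0 \<le> C" using nonneg[of 0] bd[of 0] by linarith
  have \<theta>0: "0 \<le> \<theta>" using \<theta> by simp
  let ?I = "\<integral>\<^sup>+y. ennreal (\<Phi> y * indicator {0..1} y) \<partial>lborel"
  let ?F = "\<lambda>S x. \<Phi> (g x) * \<bar>g' x\<bar> powr (1 + \<theta>) * indicator S x"
  show ?case
  proof (cases "sign_split g' (2 ^ k) a b")
    case True
    have "(\<integral>\<^sup>+x. ennreal (?F {a..b} x) \<partial>lborel) \<le> ennreal (real (2 ^ k) * \<sigma> powr \<theta>) * ?I"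
      using Suc.prems by (intro nn_integral_sign_split True nonneg \<theta>0) auto
    also have "\<dots> \<le> ennreal (2 ^ k * \<sigma> powr \<theta>) * ?I + ennreal (C * \<sigma> powr (1 + \<theta>) / 2 ^ Suc N)"
      by simp
    finally show ?thesis .
  next
    case False
    with dich Suc.prems have small: "\<And>x. x \<in> {a..b} \<Longrightarrow> \<bar>g' x\<bar> \<le> Q * (b - a) ^ k" by blast
    define c where "c = (a + b) / 2"
    \<comment> \<open>Without a sign split \<open>\<bar>g'\<bar>\<close> is at most
      \<open>Q * (b - a) ^ k\<close>, hence at most \<tau> by the last assumption. Halving the
      interval divides the left side of that assumption by \<open>2 ^ k\<close>, so both halves
      satisfy it with \<tau> in place of \<sigma>.\<close>
    define \<tau> where "\<tau> = \<sigma> / 2 ^ k"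
    have c: "a \<le> c" "c \<le> b" "c - a = (b - a) / 2" "b - c = (b - a) / 2"
      using Suc.prems by (auto simp: c_def field_simps)
    have Q\<tau>: "Q * (b - a) ^ k \<le> \<tau>" using Suc.prems(6) by (simp add: \<tau>_def field_simps)
    then have g'\<tau>: "\<And>x. x \<in> {a..b} \<Longrightarrow> \<bar>g' x\<bar> \<le> \<tau>" using small by force
    have half: "2 ^ k * Q * ((b - a) / 2) ^ k \<le> \<tau>" using Q\<tau> by (simp add: power_divide)
    \<comment> \<open>This is where the value \<open>2 / k\<close> of \<theta> is used.\<close>
    have "((2::real) ^ k) powr \<theta> = 4"
      using \<open>1 \<le> k\<close> by (simp add: \<theta> powr_realpow[symmetric] powr_powr powr_numeral)
    then have \<tau>\<theta>: "\<tau> powr \<theta> = \<sigma> powr \<theta> / 4"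
      using Suc.prems(4) by (simp add: \<tau>_def powr_divide)
    have "\<tau> powr (1 + \<theta>) = \<sigma> powr (1 + \<theta>) / (2 ^ k * 4)"
    proof -
      have "\<tau> powr (1 + \<theta>) = \<tau> * \<tau> powr \<theta>" using Suc.prems(4) by (simp add: \<tau>_def powr_add)
      also have "\<dots> = \<sigma> * \<sigma> powr \<theta> / (2 ^ k * 4)" unfolding \<tau>\<theta> by (simp add: \<tau>_def)
      also have "\<sigma> * \<sigma> powr \<theta> = \<sigma> powr (1 + \<theta>)" using Suc.prems(4) by (simp add: powr_add)
      finally show ?thesis .
    qed
    also have "\<dots> \<le> \<sigma> powr (1 + \<theta>) / (1 * 4)"
      by (intro divide_left_mono mult_right_mono) auto
    finally have \<tau>1: "\<tau> powr (1 + \<theta>) \<le> \<sigma> powr (1 + \<theta>) / 4" by simp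
    have "0 \<le> \<tau>" using Suc.prems(4) by (simp add: \<tau>_def)
    have bound: "(\<integral>\<^sup>+x. ennreal (?F {u..v} x) \<partial>lborel)
      \<le> ennreal (2 ^ k * \<tau> powr \<theta>) * ?I + ennreal (C * \<tau> powr (1 + \<theta>) / 2 ^ N)"
      if "a \<le> u" "u \<le> v" "v \<le> b" "v - u = (b - a) / 2" for u v
    proof -
      have *: "2 ^ k * Q * (v - u) ^ k \<le> \<tau>" using half by (simp only: that(4))
      then show ?thesis using that Suc.prems \<open>0 \<le> \<tau>\<close> by (intro Suc.IH *) (auto intro: g'\<tau>)
    qed
    have "(\<integral>\<^sup>+x. ennreal (?F {a..b} x) \<partial>lborel)
      \<le> (\<integral>\<^sup>+x. ennreal (?F {a..c} x) + ennreal (?F {c..b} x) \<partial>lborel)"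
      by (intro nn_integral_mono) (auto simp: indicator_def)
    also have "\<dots> = (\<integral>\<^sup>+x. ennreal (?F {a..c} x) \<partial>lborel) + (\<integral>\<^sup>+x. ennreal (?F {c..b} x) \<partial>lborel)"
      by (intro nn_integral_add) simp_all
    also have "\<dots> \<le> (ennreal (2 ^ k * \<tau> powr \<theta>) * ?I + ennreal (C * \<tau> powr (1 + \<theta>) / 2 ^ N))
      + (ennreal (2 ^ k * \<tau> powr \<theta>) * ?I + ennreal (C * \<tau> powr (1 + \<theta>) / 2 ^ N))"
      using c by (intro add_mono bound) auto
    also have "\<dots> = (ennreal (2 ^ k * \<tau> powr \<theta>) + ennreal (2 ^ k * \<tau> powr \<theta>)) * ?I
      + (ennreal (C * \<tau> powr (1 + \<theta>) / 2 ^ N) + ennreal (C * \<tau> powr (1 + \<theta>) / 2 ^ N))"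
      by (simp add: distrib_right add_ac)
    also have "\<dots> = ennreal (2 * (2 ^ k * \<tau> powr \<theta>)) * ?I + ennreal (2 * (C * \<tau> powr (1 + \<theta>) / 2 ^ N))"
      using \<open>0 \<le> C\<close> by (simp add: mult_ac ennreal_plus[symmetric] del: ennreal_plus)
    \<comment> \<open>Two halves with a gain of 4 each leave a factor 1/2. The main term thus does
      not grow with the depth, and the remainder receives one more factor 1/2.\<close>
    also have "\<dots> \<le> ennreal (2 ^ k * \<sigma> powr \<theta>) * ?I + ennreal (C * \<sigma> powr (1 + \<theta>) / 2 ^ Suc N)"
    proof (intro add_mono mult_right_mono ennreal_leI)
      have "2 * (C * \<tau> powr (1 + \<theta>) / 2 ^ N) \<le> 2 * (C * (\<sigma> powr (1 + \<theta>) / 4) / 2 ^ N)"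
        using \<tau>1 \<open>0 \<le> C\<close> by (intro mult_left_mono divide_right_mono) auto
      then show "2 * (C * \<tau> powr (1 + \<theta>) / 2 ^ N) \<le> C * \<sigma> powr (1 + \<theta>) / 2 ^ Suc N"
        by simp
    qed (auto simp: \<tau>\<theta>)
    finally show ?thesis .
  qed
qed

text \<open>The depth \<open>N\<close> of the bisection tends to infinity. The bound
  \<open>C\<close> on \<Phi> enters only the remainder and disappears with it, so the resulting
  constant can be iterated along an orbit.\<close>

lemma nn_integral_transfer:
  fixes \<Phi> :: "real \<Rightarrow> real"
  assumes "1 \<le> k" "0 \<le> Q"
    and dich: "\<And>a b. 0 \<le> a \<Longrightarrow> a \<le> b \<Longrightarrow> b \<le> 1 \<Longrightarrow>
      (\<forall>x\<in>{a..b}. \<bar>g' x\<bar> \<le> Q * (b - a) ^ k) \<or> sign_split g' (2 ^ k) a b"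
    and [measurable]: "\<Phi> \<in> borel_measurable borel"
    and nonneg: "\<And>x. 0 \<le> \<Phi> x" and bd: "\<And>x. \<Phi> x \<le> C"
    and \<theta>: "\<theta> = 2 / real k"
    and "0 \<le> a" "a \<le> b" "b \<le> 1" "0 \<le> \<sigma>"
    and "\<And>x. x \<in> {a..b} \<Longrightarrow> \<bar>g' x\<bar> \<le> \<sigma>" "2 ^ k * Q * (b - a) ^ k \<le> \<sigma>"
  shows "(\<integral>\<^sup>+x. ennreal (\<Phi> (g x) * \<bar>g' x\<bar> powr (1 + \<theta>) * indicator {a..b} x) \<partial>lborel)
       \<le> ennreal (2 ^ k * \<sigma> powr \<theta>) * (\<integral>\<^sup>+y. ennreal (\<Phi> y * indicator {0..1} y) \<partial>lborel)"
proof (rule ennreal_le_epsilon)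
  fix e :: real assume "0 < e"
  have "(\<lambda>N. C * \<sigma> powr (1 + \<theta>) * (1 / 2) ^ N) \<longlonglongrightarrow> C * \<sigma> powr (1 + \<theta>) * 0"
    by (intro tendsto_intros LIMSEQ_realpow_zero) auto
  then have "\<forall>\<^sub>F N in sequentially. C * \<sigma> powr (1 + \<theta>) * (1 / 2) ^ N < e"
    using \<open>0 < e\<close> by (intro order_tendstoD) auto
  then obtain N where N: "C * \<sigma> powr (1 + \<theta>) / 2 ^ N < e"
    by (auto simp: eventually_sequentially power_divide)
  have "(\<integral>\<^sup>+x. ennreal (\<Phi> (g x) * \<bar>g' x\<bar> powr (1 + \<theta>) * indicator {a..b} x) \<partial>lborel)
       \<le> ennreal (2 ^ k * \<sigma> powr \<theta>) * (\<integral>\<^sup>+y. ennreal (\<Phi> y * indicator {0..1} y) \<partial>lborel)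
         + ennreal (C * \<sigma> powr (1 + \<theta>) / 2 ^ N)"
    by (rule nn_integral_bisect[OF assms])
  also have "\<dots> \<le> ennreal (2 ^ k * \<sigma> powr \<theta>) * (\<integral>\<^sup>+y. ennreal (\<Phi> y * indicator {0..1} y) \<partial>lborel)
         + ennreal e"
    using N by (intro add_left_mono ennreal_leI) simp
  finally show "(\<integral>\<^sup>+x. ennreal (\<Phi> (g x) * \<bar>g' x\<bar> powr (1 + \<theta>) * indicator {a..b} x) \<partial>lborel)
       \<le> ennreal (2 ^ k * \<sigma> powr \<theta>) * (\<integral>\<^sup>+y. ennreal (\<Phi> y * indicator {0..1} y) \<partial>lborel)
         + ennreal e" .
qed

end

subsection \<open>Variation on Bowen balls\<close>

text \<open>The derivative of \<open>g ^^ n\<close> given by the chain rule. As an explicit product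
  it is multiplicative along orbits at every real point, although it is a derivative only on the
  unit interval.\<close>

definition chain_deriv :: "(real \<Rightarrow> real) \<Rightarrow> (real \<Rightarrow> real) \<Rightarrow> nat \<Rightarrow> real \<Rightarrow> real" where
  "chain_deriv g g' n x = (\<Prod>i<n. g' ((g ^^ i) x))"

lemma chain_deriv_0 [simp]: "chain_deriv g g' 0 x = 1"
  by (simp add: chain_deriv_def)

lemma chain_deriv_Suc: "chain_deriv g g' (Suc n) x = g' x * chain_deriv g g' n (g x)"
  by (simp add: chain_deriv_def prod.lessThan_Suc_shift funpow_swap1 del: prod.lessThan_Suc)

lemma chain_deriv_add:
  "chain_deriv g g' (m + n) x = chain_deriv g g' m x * chain_deriv g g' n ((g ^^ m) x)"
  by (induction m arbitrary: x) (auto simp: chain_deriv_Suc funpow_swap1)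

lemma chain_deriv_funpow:
  "chain_deriv (g ^^ m) (chain_deriv g g' m) n x = chain_deriv g g' (m * n) x"
  by (induction n arbitrary: x) (auto simp: chain_deriv_Suc chain_deriv_add)

text \<open>The ball is closed: its weak inequality is the negation of the strict one in
  \<open>dyn_separated\<close>, so that a maximal separated set gives a cover.\<close>

definition bowen_ball :: "(real \<Rightarrow> real) \<Rightarrow> nat \<Rightarrow> real \<Rightarrow> real \<Rightarrow> real set" where
  "bowen_ball g n \<epsilon> e = {x\<in>{0..1}. \<forall>i<n. \<bar>(g ^^ i) x - (g ^^ i) e\<bar> \<le> \<epsilon>}"

lemma bowen_ball_Suc:
  assumes "x \<in> bowen_ball g (Suc n) \<epsilon> e" "g ` {0..1} \<subseteq> {0..1}"
  shows "\<bar>x - e\<bar> \<le> \<epsilon>" "g x \<in> bowen_ball g n \<epsilon> (g e)"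
proof -
  have x: "x \<in> {0..1}" and le: "\<And>i. i < Suc n \<Longrightarrow> \<bar>(g ^^ i) x - (g ^^ i) e\<bar> \<le> \<epsilon>"
    using assms(1) by (auto simp: bowen_ball_def)
  show "\<bar>x - e\<bar> \<le> \<epsilon>" using le[of 0] by simp
  show "g x \<in> bowen_ball g n \<epsilon> (g e)"
    using le[of "Suc _"] imageI[OF x, of g] assms(2) by (auto simp: bowen_ball_def funpow_swap1)
qed

context unit_interval_C1_map
begin

lemma funpow_cont: "continuous_on UNIV (g ^^ n)"
proof (induction n)
  case (Suc n)
  then show ?case using continuous_on_compose2[OF cont Suc] by (simp add: o_def)
qed (simp add: id_def)

lemma funpow_range: "x \<in> {0..1} \<Longrightarrow> (g ^^ n) x \<in> {0..1}"
  using range by (cases n) auto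

lemma chain_deriv_cont: "continuous_on UNIV (chain_deriv g g' n)"
  unfolding chain_deriv_def
  by (intro continuous_on_prod continuous_on_compose2[OF cont' funpow_cont]) auto

lemma chain_deriv_borel [measurable]: "chain_deriv g g' n \<in> borel_measurable borel"
  by (intro borel_measurable_continuous_onI chain_deriv_cont)

lemma funpow_deriv:
  "x \<in> {0..1} \<Longrightarrow> ((g ^^ n) has_real_derivative chain_deriv g g' n x) (at x within {0..1})"
proof (induction n arbitrary: x)
  case 0
  then show ?case by (simp add: id_def)
next
  case (Suc n)
  have "g ` {0..1} \<subseteq> {0..1}" using range by blast
  then have "((g ^^ n) has_real_derivative chain_deriv g g' n (g x)) (at (g x) within g ` {0..1})"
    using Suc.IH[of "g x"] range by (metis DERIV_subset)
  from DERIV_image_chain[OF this deriv[OF Suc.prems]] show ?case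
    by (simp only: chain_deriv_Suc funpow_Suc_right mult.commute)
qed

lemma chain_deriv_bound:
  assumes "\<And>x. x \<in> {0..1} \<Longrightarrow> \<bar>g' x\<bar> \<le> L" "x \<in> {0..1}"
  shows "\<bar>chain_deriv g g' n x\<bar> \<le> L ^ n"
  unfolding chain_deriv_def abs_prod
  using prod_mono[of "{..<n}" "\<lambda>i. \<bar>g' ((g ^^ i) x)\<bar>" "\<lambda>_. L"] assms funpow_range[OF assms(2)] by auto

text \<open>The case \<open>m = 0\<close> is excluded because the identity does not map the whole
  line into the unit interval.\<close>

lemma iterate: "1 \<le> m \<Longrightarrow> unit_interval_C1_map (g ^^ m) (chain_deriv g g' m)"
  using funpow_cont chain_deriv_cont funpow_deriv range
  by unfold_locales (auto elim!: Suc_le_D[THEN exE] simp flip: atLeastAtMost_iff)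

lemma bowen_ball_borel [measurable]: "bowen_ball g n \<epsilon> e \<in> sets borel"
proof -
  have "closed (bowen_ball g n \<epsilon> e)"
  proof -
    have "bowen_ball g n \<epsilon> e = {0..1} \<inter> (\<Inter>i<n. {x. \<bar>(g ^^ i) x - (g ^^ i) e\<bar> \<le> \<epsilon>})"
      by (auto simp: bowen_ball_def)
    then show ?thesis
      by (auto intro!: closed_Int closed_INT closed_Collect_le continuous_intros funpow_cont)
  qed
  then show ?thesis by simp
qed

text \<open>Induction on \<open>n\<close> that splits off the first step of the orbit. A point of
  the ball lies within \<epsilon> of \<open>e\<close>, and its image lies in the ball of time
  \<open>n\<close> about \<open>g e\<close>. By the chain rule the integrand is a weight \<Phi> at
  \<open>g x\<close> times \<open>\<bar>g' x\<bar> powr (1 + \<theta>)\<close>, so one transfer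
  costs the factor \<open>2 ^ k * \<sigma> powr \<theta>\<close>.\<close>

lemma nn_integral_bowen_ball:
  assumes "1 \<le> k" "0 \<le> Q"
    and dich: "\<And>a b. 0 \<le> a \<Longrightarrow> a \<le> b \<Longrightarrow> b \<le> 1 \<Longrightarrow>
      (\<forall>x\<in>{a..b}. \<bar>g' x\<bar> \<le> Q * (b - a) ^ k) \<or> sign_split g' (2 ^ k) a b"
    and \<theta>: "\<theta> = 2 / real k"
    and \<sigma>: "\<And>x. x \<in> {0..1} \<Longrightarrow> \<bar>g' x\<bar> \<le> \<sigma>" "2 ^ k * Q * (2 * \<epsilon>) ^ k \<le> \<sigma>"
    and "0 < \<epsilon>" "e \<in> {0..1}"
  shows "(\<integral>\<^sup>+x. ennreal (\<bar>chain_deriv g g' n x\<bar> powr (1 + \<theta>) * indicator (bowen_ball g n \<epsilon> e) x) \<partial>lborel)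
    \<le> ennreal ((2 ^ k * \<sigma> powr \<theta>) ^ n)"
  using \<open>e \<in> {0..1}\<close>
proof (induction n arbitrary: e)
  case 0
  have "(\<integral>\<^sup>+x. ennreal (indicator {0..1::real} x) \<partial>lborel) = 1"
    by (simp add: ennreal_indicator)
  moreover have "bowen_ball g 0 \<epsilon> e = {0..1}" by (auto simp: bowen_ball_def)
  ultimately show ?case by simp
next
  case (Suc n)
  define a where "a = max 0 (e - \<epsilon>)"
  define b where "b = min 1 (e + \<epsilon>)"
  have ab: "0 \<le> a" "a \<le> b" "b \<le> 1" "b - a \<le> 2 * \<epsilon>"
    using Suc.prems \<open>0 < \<epsilon>\<close> by (auto simp: a_def b_def)
  have "0 \<le> \<sigma>" using \<sigma>(1)[of 0] by (simp add: order_trans[OF abs_ge_zero])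
  have \<theta>0: "0 \<le> \<theta>" using \<theta> by simp
  \<comment> \<open>The integrand of the induction hypothesis at the centre \<open>g e\<close>; it
    vanishes off the ball, which lies in the unit interval, so the derivative bound gives an upper
    bound everywhere.\<close>
  define \<Phi> where "\<Phi> x = \<bar>chain_deriv g g' n x\<bar> powr (1 + \<theta>) * indicator (bowen_ball g n \<epsilon> (g e)) x" for x
  have \<Phi>_borel: "\<Phi> \<in> borel_measurable borel" unfolding \<Phi>_def by measurable
  have \<Phi>_nonneg: "0 \<le> \<Phi> x" for x by (simp add: \<Phi>_def)
  have \<Phi>_bd: "\<Phi> x \<le> (\<sigma> ^ n) powr (1 + \<theta>)" for x
  proof (cases "x \<in> bowen_ball g n \<epsilon> (g e)")
    case True
    then have "\<bar>chain_deriv g g' n x\<bar> \<le> \<sigma> ^ n"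
      by (intro chain_deriv_bound \<sigma>) (auto simp: bowen_ball_def)
    then show ?thesis using True \<theta>0 by (auto simp: \<Phi>_def intro!: powr_mono2)
  qed (simp add: \<Phi>_def)
  have "g ` {0..1} \<subseteq> {0..1}" using range by blast
  note ball = bowen_ball_Suc[OF _ this]
  have "(\<integral>\<^sup>+x. ennreal (\<bar>chain_deriv g g' (Suc n) x\<bar> powr (1 + \<theta>) * indicator (bowen_ball g (Suc n) \<epsilon> e) x) \<partial>lborel)
    \<le> (\<integral>\<^sup>+x. ennreal (\<Phi> (g x) * \<bar>g' x\<bar> powr (1 + \<theta>) * indicator {a..b} x) \<partial>lborel)"
  proof (intro nn_integral_mono ennreal_leI)
    fix x
    show "\<bar>chain_deriv g g' (Suc n) x\<bar> powr (1 + \<theta>) * indicator (bowen_ball g (Suc n) \<epsilon> e) x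
      \<le> \<Phi> (g x) * \<bar>g' x\<bar> powr (1 + \<theta>) * indicator {a..b} x"
    proof (cases "x \<in> bowen_ball g (Suc n) \<epsilon> e")
      case True
      then have "x \<in> {a..b}" using ball(1)[OF True] by (auto simp: a_def b_def bowen_ball_def)
      then show ?thesis using True ball(2)[OF True]
        by (simp add: \<Phi>_def chain_deriv_Suc abs_mult powr_mult mult.commute)
    qed (simp add: \<Phi>_nonneg)
  qed
  also have "\<dots> \<le> ennreal (2 ^ k * \<sigma> powr \<theta>) * (\<integral>\<^sup>+y. ennreal (\<Phi> y * indicator {0..1} y) \<partial>lborel)"
  proof (rule nn_integral_transfer[OF assms(1,2) dich \<Phi>_borel \<Phi>_nonneg \<Phi>_bd \<theta> ab(1-3) \<open>0 \<le> \<sigma>\<close>])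
    show "2 ^ k * Q * (b - a) ^ k \<le> \<sigma>"
      using ab \<open>0 \<le> Q\<close> by (intro order_trans[OF _ \<sigma>(2)] mult_left_mono power_mono) auto
  qed (use ab \<sigma> in auto)
  also have "\<dots> \<le> ennreal (2 ^ k * \<sigma> powr \<theta>) * ennreal ((2 ^ k * \<sigma> powr \<theta>) ^ n)"
  proof (intro mult_left_mono)
    have "(\<integral>\<^sup>+y. ennreal (\<Phi> y * indicator {0..1} y) \<partial>lborel) \<le> (\<integral>\<^sup>+y. ennreal (\<Phi> y) \<partial>lborel)"
      by (intro nn_integral_mono ennreal_leI) (simp add: \<Phi>_nonneg indicator_def)
    also have "\<dots> \<le> ennreal ((2 ^ k * \<sigma> powr \<theta>) ^ n)"
      unfolding \<Phi>_def by (rule Suc.IH[OF range])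
    finally show "(\<integral>\<^sup>+y. ennreal (\<Phi> y * indicator {0..1} y) \<partial>lborel) \<le> ennreal ((2 ^ k * \<sigma> powr \<theta>) ^ n)" .
  qed simp
  also have "\<dots> = ennreal ((2 ^ k * \<sigma> powr \<theta>) ^ Suc n)"
    by (simp add: ennreal_mult'[symmetric])
  finally show ?case .
qed

text \<open>The inequality \<open>t \<le> 1 + t powr (1 + \<theta>)\<close> for nonnegative
  \<open>t\<close> raises the exponent to the one controlled on Bowen balls, at the cost of the
  summand 1. The rest is a sum over the balls of the cover.\<close>

lemma integral_chain_deriv_le:
  assumes "1 \<le> k" "0 \<le> Q"
    and dich: "\<And>a b. 0 \<le> a \<Longrightarrow> a \<le> b \<Longrightarrow> b \<le> 1 \<Longrightarrow>
      (\<forall>x\<in>{a..b}. \<bar>g' x\<bar> \<le> Q * (b - a) ^ k) \<or> sign_split g' (2 ^ k) a b"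
    and \<sigma>: "\<And>x. x \<in> {0..1} \<Longrightarrow> \<bar>g' x\<bar> \<le> \<sigma>" "2 ^ k * Q * (2 * \<epsilon>) ^ k \<le> \<sigma>"
    and "0 < \<epsilon>" "finite E" "E \<subseteq> {0..1}" and cover: "{0..1} \<subseteq> (\<Union>e\<in>E. bowen_ball g n \<epsilon> e)"
  shows "integral {0..1} (\<lambda>x. \<bar>chain_deriv g g' n x\<bar>)
    \<le> 1 + real (card E) * (2 ^ k * \<sigma> powr (2 / real k)) ^ n"
proof -
  define \<theta> where "\<theta> = 2 / real k"
  define W where "W = (2 ^ k * \<sigma> powr \<theta>) ^ n"
  have "0 \<le> W" by (simp add: W_def)
  let ?D = "\<lambda>x. \<bar>chain_deriv g g' n x\<bar>"
  let ?p = "\<lambda>e x. ennreal (?D x powr (1 + \<theta>) * indicator (bowen_ball g n \<epsilon> e) x)"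
  have "?D integrable_on {0..1}"
    by (intro integrable_continuous_real continuous_intros continuous_on_subset[OF chain_deriv_cont]) simp
  then have "(?D has_integral integral {0..1} ?D) {0..1}" by (rule integrable_integral)
  then have "ennreal (integral {0..1} ?D) = (\<integral>\<^sup>+x. ennreal (indicator {0..1} x * ?D x) \<partial>lborel)"
    by (subst nn_integral_has_integral_lebesgue) auto
  also have "\<dots> \<le> (\<integral>\<^sup>+x. indicator {0..1} x + (\<Sum>e\<in>E. ?p e x) \<partial>lborel)"
  proof (intro nn_integral_mono)
    fix x
    show "ennreal (indicator {0..1} x * ?D x) \<le> indicator {0..1} x + (\<Sum>e\<in>E. ?p e x)"
    proof (cases "x \<in> {0..1}")
      case True
      then obtain e where e: "e \<in> E" "x \<in> bowen_ball g n \<epsilon> e" using cover by blast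
      have "?D x \<le> 1 + ?D x powr (1 + \<theta>)"
      proof (cases "?D x \<le> 1")
        case False
        then have "?D x powr 1 \<le> ?D x powr (1 + \<theta>)" by (intro powr_mono) (auto simp: \<theta>_def)
        then show ?thesis using False by simp
      qed (simp add: add_increasing2)
      then have "ennreal (?D x) \<le> 1 + ?p e x"
        using e(2) by (simp add: ennreal_leI flip: ennreal_1 ennreal_plus)
      also have "\<dots> \<le> 1 + (\<Sum>e\<in>E. ?p e x)"
        using \<open>finite E\<close> e(1) by (intro add_left_mono member_le_sum) auto
      finally show ?thesis using True by simp
    qed simp
  qed
  also have "\<dots> = (\<integral>\<^sup>+x. indicator {0..1::real} x \<partial>lborel) + (\<integral>\<^sup>+x. (\<Sum>e\<in>E. ?p e x) \<partial>lborel)"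
    by (intro nn_integral_add) simp_all
  also have "\<dots> = 1 + (\<Sum>e\<in>E. \<integral>\<^sup>+x. ?p e x \<partial>lborel)"
    by (subst nn_integral_sum) simp_all
  also have "\<dots> \<le> 1 + (\<Sum>e\<in>E. ennreal W)"
  proof (intro add_left_mono sum_mono)
    fix e assume "e \<in> E"
    then show "(\<integral>\<^sup>+x. ?p e x \<partial>lborel) \<le> ennreal W"
      unfolding W_def using assms by (intro nn_integral_bowen_ball[OF assms(1,2) dich]) (auto simp: \<theta>_def)
  qed
  also have "\<dots> = ennreal (1 + real (card E) * W)"
    using \<open>0 \<le> W\<close> by (simp add: ennreal_mult ennreal_of_nat_eq_real_of_nat)
  finally have "integral {0..1} ?D \<le> 1 + real (card E) * W"
    using \<open>0 \<le> W\<close> by (subst (asm) ennreal_le_iff) auto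
  then show ?thesis by (simp add: W_def \<theta>_def)
qed

end

subsection \<open>Growth of the variation\<close>

text \<open>For each \<epsilon> the upper limit is at most the entropy, hence below
  \<open>c\<close>; so the supremum itself is eventually below \<open>c\<close>.\<close>

lemma eventually_card_dyn_separated_le:
  assumes "topological_entropy X f < ereal c" "0 < \<epsilon>"
  shows "\<forall>\<^sub>F n in sequentially. \<forall>E. E \<subseteq> X \<and> finite E \<and> dyn_separated f n \<epsilon> E \<longrightarrow>
    real (card E) \<le> exp (c * real n)"
proof -
  define s where "s n = (SUP E\<in>{E. E \<subseteq> X \<and> finite E \<and> E \<noteq> {} \<and> dyn_separated f n \<epsilon> E}.
         ereal (ln (real (card E)) / real n))" for n
  have "limsup s \<le> topological_entropy X f"
    unfolding topological_entropy_def s_def using \<open>0 < \<epsilon>\<close> by (intro SUP_upper) auto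
  then have "limsup s < ereal c" using assms(1) by (rule le_less_trans)
  then have "\<forall>\<^sub>F n in sequentially. s n < ereal c" by (rule Limsup_lessD)
  \<comment> \<open>For \<open>n = 0\<close> the quotient has the default value 0 and says nothing
    about the cardinality.\<close>
  moreover have "\<forall>\<^sub>F n in sequentially. (0::nat) < n" by (rule eventually_gt_at_top)
  ultimately show ?thesis
  proof eventually_elim
    case (elim n)
    show ?case
    proof (intro allI impI)
      fix E assume E: "E \<subseteq> X \<and> finite E \<and> dyn_separated f n \<epsilon> E"
      show "real (card E) \<le> exp (c * real n)"
      proof (cases "E = {}")
        case False
        then have "ereal (ln (real (card E)) / real n) \<le> s n"
          unfolding s_def using E by (intro SUP_upper) auto
        then have "ereal (ln (real (card E)) / real n) < ereal c" using elim(1) by (rule le_less_trans)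
        then have "ln (real (card E)) \<le> c * real n" using elim(2) by (simp add: field_simps)
        moreover have "0 < card E" using False E by (simp add: card_gt_0_iff)
        ultimately show ?thesis by (metis exp_le_cancel_iff exp_ln of_nat_0_less_iff)
      qed simp
    qed
  qed
qed

text \<open>Time \<open>i\<close> of the iterate is time \<open>m * i\<close> of \<open>f\<close>.
  Hence the entropy of \<open>f\<close> itself bounds the separated sets of \<open>f ^^ m\<close>,
  and no formula for the entropy of an iterate is needed.\<close>

lemma dyn_separated_funpow:
  assumes "dyn_separated (f ^^ m) n \<epsilon> E" "1 \<le> m"
  shows "dyn_separated f (m * n) \<epsilon> E"
  unfolding dyn_separated_def
proof (intro ballI impI)
  fix x y assume "x \<in> E" "y \<in> E" "x \<noteq> y"
  with assms(1) obtain i where i: "i < n" "\<epsilon> < dist (((f ^^ m) ^^ i) x) (((f ^^ m) ^^ i) y)"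
    unfolding dyn_separated_def by blast
  moreover have "m * i < m * n" using i(1) assms(2) by simp
  ultimately show "\<exists>k<m * n. \<epsilon> < dist ((f ^^ k) x) ((f ^^ k) y)"
    unfolding funpow_mult by (metis mult.commute)
qed

text \<open>A separated set of largest cardinality, which exists because of \<open>K\<close>, works:
  a point outside all its balls could be added to it.\<close>

lemma bowen_ball_cover:
  assumes K: "\<And>E. E \<subseteq> {0..1} \<Longrightarrow> finite E \<Longrightarrow> dyn_separated g n \<epsilon> E \<Longrightarrow> real (card E) \<le> K" and "0 < \<epsilon>"
  obtains E where "finite E" "E \<subseteq> {0..1}" "real (card E) \<le> K" "{0..1} \<subseteq> (\<Union>e\<in>E. bowen_ball g n \<epsilon> e)"
proof -
  define P where "P E \<longleftrightarrow> E \<subseteq> {0..1::real} \<and> finite E \<and> dyn_separated g n \<epsilon> E" for E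
  have "P {}" by (simp add: P_def dyn_separated_def)
  moreover have "\<forall>E. P E \<longrightarrow> card E < Suc (nat \<lfloor>K\<rfloor>)"
  proof (intro allI impI)
    fix E assume "P E"
    then have "real (card E) \<le> K" using K by (simp add: P_def)
    then have "card E \<le> nat \<lfloor>K\<rfloor>" by linarith
    then show "card E < Suc (nat \<lfloor>K\<rfloor>)" by simp
  qed
  ultimately obtain E where E: "P E" and max: "\<And>E'. P E' \<Longrightarrow> card E' \<le> card E"
    using ex_has_greatest_nat[of P "{}" card] by blast
  have "\<exists>e\<in>E. x \<in> bowen_ball g n \<epsilon> e" if x: "x \<in> {0..1}" for x
  proof (rule ccontr)
    assume "\<not> ?thesis"
    then have far: "\<forall>e\<in>E. \<exists>i<n. \<epsilon> < \<bar>(g ^^ i) x - (g ^^ i) e\<bar>"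
      using x unfolding bowen_ball_def by force
    then have "x \<notin> E" using \<open>0 < \<epsilon>\<close> by force
    have "dyn_separated g n \<epsilon> (insert x E)"
      using E far unfolding P_def dyn_separated_def dist_real_def
      by (auto simp: abs_minus_commute)
    then have "P (insert x E)" using E x by (simp add: P_def)
    then show False using max[of "insert x E"] \<open>x \<notin> E\<close> E by (simp add: P_def)
  qed
  then have "{0..1} \<subseteq> (\<Union>e\<in>E. bowen_ball g n \<epsilon> e)" by blast
  then show thesis using that[of E] E K by (simp add: P_def)
qed

context unit_interval_C1_map
begin

lemma chain_deriv_C_k:
  assumes "C_k_on k g {0..1}" "C_k_on k g' {0..1}"
  shows "C_k_on k (chain_deriv g g' n) {0..1}"
proof (induction n)
  case 0
  then show ?case using C_k_on_const[of k 1] by (rule C_k_on_cong) simp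
next
  case (Suc n)
  have "C_k_on k (\<lambda>x. g' x * chain_deriv g g' n (g x)) {0..1}"
    using range by (intro C_k_on_mult C_k_on_compose[OF Suc] assms) auto
  then show ?case by (rule C_k_on_cong) (simp add: chain_deriv_Suc)
qed

lemma integral_chain_deriv_abs_integrable: "(\<lambda>x. \<bar>chain_deriv g g' n x\<bar>) integrable_on {a..b}"
  by (intro integrable_continuous_real continuous_intros continuous_on_subset[OF chain_deriv_cont]) simp

text \<open>The integral is the variation of \<open>g ^^ n\<close>. It is shown to grow at a rate at
  most \<open>r\<close> with \<open>exp r < \<mu>\<close>, so a geometric series dominates.\<close>

lemma summable_integral_chain_deriv:
  assumes C_k: "\<And>k. C_k_on k g {0..1}" "\<And>k. C_k_on k g' {0..1}"
    and ent: "topological_entropy {0..1} g < ereal c" and "0 \<le> c" "exp c < \<mu>"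
  shows "summable (\<lambda>n. integral {0..1} (\<lambda>x. \<bar>chain_deriv g g' n x\<bar>) / \<mu> ^ n)"
proof -
  let ?v = "\<lambda>n. integral {0..1} (\<lambda>x. \<bar>chain_deriv g g' n x\<bar>)"
  have "0 < \<mu>" using \<open>exp c < \<mu>\<close> exp_gt_zero[of c] by linarith
  have "compact (g' ` {0..1})"
    by (intro compact_continuous_image continuous_on_subset[OF cont']) auto
  then obtain L0 where L0: "\<forall>x\<in>{0..1}. \<bar>g' x\<bar> \<le> L0"
    using compact_imp_bounded[of "g' ` {0..1}"] by (auto simp: bounded_iff)
  define L where "L = max 1 L0"
  have "1 \<le> L" and L: "\<And>x. x \<in> {0..1} \<Longrightarrow> \<bar>g' x\<bar> \<le> L"
    using L0 unfolding L_def by (force simp: le_max_iff_disj)+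
  \<comment> \<open>The room available for the two losses, one half for each.\<close>
  define d where "d = ln \<mu> - c"
  have "0 < d" using \<open>exp c < \<mu>\<close> \<open>0 < \<mu>\<close> by (metis d_def diff_gt_0_iff_gt exp_less_cancel_iff exp_ln)
  \<comment> \<open>A large \<open>k\<close> brings the loss \<open>2 / k * ln L\<close> from the
    exponent \<theta> below \<open>d / 2\<close>.\<close>
  obtain k where k: "4 * ln L / d < real k" using reals_Archimedean2 by blast
  moreover have "0 \<le> 4 * ln L / d" using \<open>1 \<le> L\<close> \<open>0 < d\<close> by simp
  ultimately have "0 < k" using of_nat_0_less_iff[of k, where ?'a = real] by linarith
  \<comment> \<open>With \<open>k\<close> fixed, the factor \<open>2 ^ k\<close> is paid once per
    step of \<open>g ^^ m\<close>; a large \<open>m\<close> brings its share per step of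
    \<open>g\<close> below \<open>d / 2\<close>.\<close>
  obtain m where m: "2 * (real k * ln 2) / d < real m" using reals_Archimedean2 by blast
  moreover have "0 \<le> 2 * (real k * ln 2) / d" using \<open>0 < d\<close> by simp
  ultimately have "0 < m" using of_nat_0_less_iff[of m, where ?'a = real] by linarith
  define r where "r = c + real k * ln 2 / real m + 2 / real k * ln L"
  have "2 / real k * ln L < d / 2" using k \<open>0 < k\<close> \<open>0 < d\<close> by (simp add: field_simps)
  moreover have "real k * ln 2 / real m < d / 2" using m \<open>0 < m\<close> \<open>0 < d\<close> by (simp add: field_simps)
  ultimately have "real k * ln 2 / real m + 2 / real k * ln L < d / 2 + d / 2"
    by (intro add_strict_mono)
  then have "r < ln \<mu>" unfolding r_def d_def by argo
  have "0 \<le> r" using \<open>0 \<le> c\<close> \<open>1 \<le> L\<close> by (simp add: r_def)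
  have W: "2 ^ k * (L ^ m) powr (2 / real k) = exp (real m * (r - c))"
  proof -
    have "2 ^ k * (L ^ m) powr (2 / real k) = exp (real k * ln 2) * exp (2 / real k * (real m * ln L))"
      using \<open>1 \<le> L\<close> by (simp add: powr_def ln_realpow exp_of_nat_mult)
    also have "\<dots> = exp (real m * (r - c))"
      using \<open>0 < m\<close> by (simp add: r_def field_simps flip: exp_add)
    finally show ?thesis .
  qed

  interpret h: unit_interval_C1_map "g ^^ m" "chain_deriv g g' m"
    using \<open>0 < m\<close> by (intro iterate) simp
  obtain Q where "0 \<le> Q" and dich: "\<And>a b. 0 \<le> a \<Longrightarrow> a \<le> b \<Longrightarrow> b \<le> 1 \<Longrightarrow>
      (\<forall>x\<in>{a..b}. \<bar>chain_deriv g g' m x\<bar> \<le> Q * (b - a) ^ k) \<or> sign_split (chain_deriv g g' m) (2 ^ k) a b"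
    using C_k_on_small_or_sign_split[OF chain_deriv_C_k[OF C_k], of m k] by metis
  \<comment> \<open>Chosen so that \<open>(1 + Q) * (4 * \<epsilon>) = 1\<close>, which makes
    \<open>Q * (4 * \<epsilon>) ^ k\<close> at most 1.\<close>
  define \<epsilon> where "\<epsilon> = 1 / (4 * (1 + Q))"
  have "0 < \<epsilon>" using \<open>0 \<le> Q\<close> by (simp add: \<epsilon>_def)
  have Q\<epsilon>: "2 ^ k * Q * (2 * \<epsilon>) ^ k \<le> L ^ m"
  proof -
    have "(4 * \<epsilon>) ^ k = (2 * (2 * \<epsilon>)) ^ k" by simp
    also have "\<dots> = 2 ^ k * (2 * \<epsilon>) ^ k" by (rule power_mult_distrib)
    finally have "2 ^ k * Q * (2 * \<epsilon>) ^ k = Q * (4 * \<epsilon>) ^ k" by (simp only: mult_ac)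
    also have "\<dots> \<le> (1 + Q) * (4 * \<epsilon>) ^ 1"
      using \<open>0 < k\<close> \<open>0 \<le> Q\<close> \<open>0 < \<epsilon>\<close> by (intro mult_mono power_decreasing) (auto simp: \<epsilon>_def)
    also have "\<dots> = 1" using \<open>0 \<le> Q\<close> by (simp add: \<epsilon>_def)
    also have "\<dots> \<le> L ^ m" using \<open>1 \<le> L\<close> by simp
    finally show ?thesis .
  qed
  \<comment> \<open>At most \<open>exp (c * m * n)\<close> balls of the iterate cover the interval,
    and each contributes \<open>exp (m * (r - c)) ^ n\<close>; the product has rate
    \<open>r\<close>.\<close>
  have multiples: "?v (m * n) \<le> 1 + exp (r * real (m * n))"
    if sep: "\<forall>E. E \<subseteq> {0..1} \<and> finite E \<and> dyn_separated g (m * n) \<epsilon> E \<longrightarrow>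
      real (card E) \<le> exp (c * real (m * n))" for n
  proof -
    obtain E where E: "finite E" "E \<subseteq> {0..1}" "real (card E) \<le> exp (c * real (m * n))"
      "{0..1} \<subseteq> (\<Union>e\<in>E. bowen_ball (g ^^ m) n \<epsilon> e)"
    proof (rule bowen_ball_cover[OF _ \<open>0 < \<epsilon>\<close>, of "g ^^ m" n "exp (c * real (m * n))"])
      fix E assume "E \<subseteq> {0..1}" "finite E" "dyn_separated (g ^^ m) n \<epsilon> E"
      then show "real (card E) \<le> exp (c * real (m * n))"
        using sep dyn_separated_funpow[of m g n \<epsilon> E] \<open>0 < m\<close> by simp
    qed
    have "?v (m * n) \<le> 1 + real (card E) * (2 ^ k * (L ^ m) powr (2 / real k)) ^ n"
      using h.integral_chain_deriv_le[OF _ \<open>0 \<le> Q\<close> dich chain_deriv_bound[OF L] Q\<epsilon> \<open>0 < \<epsilon>\<close> E(1,2,4)] \<open>0 < k\<close>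
      by (simp add: chain_deriv_funpow)
    also have "\<dots> \<le> 1 + exp (c * real (m * n)) * exp (real m * (r - c)) ^ n"
      unfolding W using E(3) by (intro add_left_mono mult_right_mono) auto
    also have "exp (c * real (m * n)) * exp (real m * (r - c)) ^ n = exp (r * real (m * n))"
      by (simp add: algebra_simps flip: exp_add exp_of_nat_mult)
    finally show ?thesis .
  qed
  \<comment> \<open>Between multiples of \<open>m\<close> fewer than \<open>m\<close> factors of the
    product are left over, and together they are at most \<open>L ^ m\<close>.\<close>
  have bound: "?v n \<le> L ^ m * (2 * exp (r * real n))"
    if v: "?v (m * (n div m)) \<le> 1 + exp (r * real (m * (n div m)))" for n
  proof -
    define q where "q = m * (n div m)"
    have q: "q + n mod m = n" by (simp add: q_def)
    have "?v n \<le> integral {0..1} (\<lambda>x. L ^ m * \<bar>chain_deriv g g' q x\<bar>)"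
    proof (intro integral_le integral_chain_deriv_abs_integrable)
      show "(\<lambda>x. L ^ m * \<bar>chain_deriv g g' q x\<bar>) integrable_on {0..1}"
        using integrable_on_cmult_left[OF integral_chain_deriv_abs_integrable, of "L ^ m"] by simp
    next
      fix x :: real assume x: "x \<in> {0..1}"
      have "\<bar>chain_deriv g g' (n mod m) ((g ^^ q) x)\<bar> \<le> L ^ (n mod m)"
        by (intro chain_deriv_bound L funpow_range x)
      also have "\<dots> \<le> L ^ m" using \<open>1 \<le> L\<close> \<open>0 < m\<close> by (intro power_increasing) auto
      finally have "\<bar>chain_deriv g g' q x\<bar> * \<bar>chain_deriv g g' (n mod m) ((g ^^ q) x)\<bar>
        \<le> \<bar>chain_deriv g g' q x\<bar> * L ^ m" by (intro mult_left_mono) auto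
      then show "\<bar>chain_deriv g g' n x\<bar> \<le> L ^ m * \<bar>chain_deriv g g' q x\<bar>"
        using chain_deriv_add[of g g' q "n mod m" x] q by (simp add: abs_mult mult.commute)
    qed
    also have "\<dots> = L ^ m * ?v q" by simp
    also have "\<dots> \<le> L ^ m * (1 + exp (r * real q))"
      using v \<open>1 \<le> L\<close> by (intro mult_left_mono) (auto simp: q_def)
    also have "\<dots> \<le> L ^ m * (exp (r * real n) + exp (r * real n))"
      using \<open>1 \<le> L\<close> \<open>0 \<le> r\<close> q by (intro mult_left_mono add_mono) (auto intro!: mult_left_mono)
    finally show ?thesis by simp
  qed
  \<comment> \<open>The bound on separated sets holds only eventually, so the multiples
    \<open>m * (n div m)\<close> must tend to infinity.\<close>
  have "filterlim (\<lambda>n. m * (n div m)) at_top sequentially"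
    unfolding filterlim_at_top
  proof
    fix Z
    have "Z \<le> m * (n div m)" if "Z + m \<le> n" for n
      using that mod_less_divisor[OF \<open>0 < m\<close>, of n] mult_div_mod_eq[of m n] by linarith
    then show "\<forall>\<^sub>F n in sequentially. Z \<le> m * (n div m)"
      unfolding eventually_sequentially by blast
  qed
  from eventually_compose_filterlim[OF eventually_card_dyn_separated_le[OF ent \<open>0 < \<epsilon>\<close>] this]
  have "\<forall>\<^sub>F n in sequentially. ?v n \<le> L ^ m * (2 * exp (r * real n))"
    by (rule eventually_mono) (intro bound multiples, simp)
  then have "\<forall>\<^sub>F n in sequentially. norm (?v n / \<mu> ^ n) \<le> 2 * L ^ m * (exp r / \<mu>) ^ n"
  proof eventually_elim
    case (elim n)
    have "0 \<le> ?v n" by (intro integral_nonneg integral_chain_deriv_abs_integrable) auto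
    then have "norm (?v n / \<mu> ^ n) = ?v n / \<mu> ^ n" using \<open>0 < \<mu>\<close> by simp
    also have "\<dots> \<le> L ^ m * (2 * exp (r * real n)) / \<mu> ^ n"
      using elim \<open>0 < \<mu>\<close> by (intro divide_right_mono) auto
    also have "\<dots> = 2 * L ^ m * (exp r / \<mu>) ^ n"
      by (simp add: power_divide mult_ac flip: exp_of_nat_mult)
    finally show ?case .
  qed
  moreover have "summable (\<lambda>n. 2 * L ^ m * (exp r / \<mu>) ^ n)"
  proof (intro summable_mult summable_geometric)
    have "exp r < \<mu>" using \<open>r < ln \<mu>\<close> \<open>0 < \<mu>\<close> by (metis exp_less_cancel_iff exp_ln)
    then show "norm (exp r / \<mu>) < 1" using \<open>0 < \<mu>\<close> by simp
  qed
  ultimately show ?thesis by (rule summable_comparison_test_ev)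
qed

end

subsection \<open>The Lipschitz conjugacy\<close>

context unit_interval_C1_map
begin

text \<open>For \<open>x\<close> in the unit interval this is the total variation of
  \<open>g ^^ n\<close> on \<open>{0..x}\<close>, written as an integral so that it is
  differentiable in \<open>x\<close>.\<close>

definition variation :: "nat \<Rightarrow> real \<Rightarrow> real" where
  "variation n x = integral {0..x} (\<lambda>t. \<bar>chain_deriv g g' n t\<bar>)"

lemma variation_deriv:
  "x \<in> {0..1} \<Longrightarrow> (variation n has_real_derivative \<bar>chain_deriv g g' n x\<bar>) (at x within {0..1})"
  unfolding variation_def
  by (intro integral_has_real_derivative continuous_intros continuous_on_subset[OF chain_deriv_cont]) auto

lemma variation_0 [simp]: "variation n 0 = 0"
  by (simp add: variation_def)

lemma variation_zeroth: "x \<in> {0..1} \<Longrightarrow> variation 0 x = x"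
  by (simp add: variation_def)

lemma variation_mono:
  assumes "0 \<le> x" "x \<le> y" "y \<le> 1"
  shows "variation n x \<le> variation n y"
  unfolding variation_def using assms
  by (intro integral_subset_le integral_chain_deriv_abs_integrable) auto

text \<open>For both signs \<open>s\<close> the function
  \<open>variation (Suc n) t - s * variation n (g t)\<close> is nondecreasing: by the chain rule the
  two derivatives have the same absolute value, and the first is nonnegative.\<close>

lemma variation_image:
  assumes "0 \<le> x" "x \<le> y" "y \<le> 1"
  shows "\<bar>variation n (g y) - variation n (g x)\<bar> \<le> variation (Suc n) y - variation (Suc n) x"
proof -
  have image: "g ` {0..1} \<subseteq> {0..1}" using range by blast
  have deriv_comp: "((\<lambda>t. variation n (g t)) has_real_derivative \<bar>chain_deriv g g' n (g t)\<bar> * g' t) (at t within {0..1})"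
    if t: "t \<in> {0..1}" for t
  proof -
    have "(variation n has_real_derivative \<bar>chain_deriv g g' n (g t)\<bar>) (at (g t) within g ` {0..1})"
      using variation_deriv[OF range] image by (rule DERIV_subset)
    from DERIV_image_chain[OF this deriv[OF t]] show ?thesis by (simp add: o_def)
  qed
  have le: "s * (variation n (g y) - variation n (g x)) \<le> variation (Suc n) y - variation (Suc n) x"
    if s: "\<bar>s\<bar> = 1" for s
  proof -
    let ?D = "\<lambda>t. \<bar>chain_deriv g g' (Suc n) t\<bar> - s * (\<bar>chain_deriv g g' n (g t)\<bar> * g' t)"
    have "\<exists>t\<in>{x..y}. (variation (Suc n) y - s * variation n (g y)) - (variation (Suc n) x - s * variation n (g x))
      = ?D t * (y - x)"
      using assms
      by (intro real_mvt_within[where S = "{0..1}" and h = "\<lambda>t. variation (Suc n) t - s * variation n (g t)" and h' = ?D])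
        (auto intro!: DERIV_diff DERIV_cmult deriv_comp variation_deriv)
    then obtain t where t: "(variation (Suc n) y - s * variation n (g y)) - (variation (Suc n) x - s * variation n (g x))
      = ?D t * (y - x)" by blast
    have "s * (\<bar>chain_deriv g g' n (g t)\<bar> * g' t) \<le> \<bar>s * (\<bar>chain_deriv g g' n (g t)\<bar> * g' t)\<bar>"
      by (rule abs_ge_self)
    also have "\<dots> = \<bar>chain_deriv g g' (Suc n) t\<bar>"
      using s by (simp add: abs_mult chain_deriv_Suc mult.commute)
    finally have "0 \<le> ?D t * (y - x)" using assms by (intro mult_nonneg_nonneg) auto
    with t show ?thesis by (simp add: algebra_simps)
  qed
  show ?thesis using le[of 1] le[of "-1"] by (simp add: abs_le_iff)
qed

text \<open>The conjugacy is \<open>\<psi> x = (\<Sum>n. variation n x / \<mu> ^ n)\<close>, normalised to map onto the unit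
  interval; \<open>g\<close> shifts the summands because \<open>g ^^ n\<close> varies over \<open>g ` J\<close> at most as much as
  \<open>g ^^ Suc n\<close> varies over \<open>J\<close>.\<close>

lemma Lipschitz_conjugacy:
  assumes "0 < \<mu>" and summable: "summable (\<lambda>n. variation n 1 / \<mu> ^ n)"
  obtains \<psi> \<psi>' :: "real \<Rightarrow> real" where "homeomorphism {0..1} {0..1} \<psi> \<psi>'" "\<mu>-lipschitz_on {0..1} (\<psi> \<circ> g \<circ> \<psi>')"
proof -
  define a where "a x n = variation n x / \<mu> ^ n" for x n
  define h where "h x = suminf (a x)" for x
  \<comment> \<open>Domination by the terms at 1 gives uniform convergence, and with it the
    continuity of \<open>h\<close>.\<close>
  have a_bound: "0 \<le> a x n \<and> a x n \<le> a 1 n" if "x \<in> {0..1}" for x n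
    using variation_mono[of 0 x n] variation_mono[of x 1 n] that \<open>0 < \<mu>\<close>
    by (auto simp: a_def intro!: divide_right_mono divide_nonneg_pos)
  have sum_a: "summable (a x)" if "x \<in> {0..1}" for x
  proof (rule summable_comparison_test')
    show "summable (a 1)" using summable by (simp add: a_def[abs_def])
    show "norm (a x n) \<le> a 1 n" for n using a_bound[OF that] by simp
  qed
  have cont_h: "continuous_on {0..1} h"
  proof (rule uniform_limit_theorem)
    show "\<forall>\<^sub>F n in sequentially. continuous_on {0..1} (\<lambda>x. \<Sum>i<n. a x i)"
    proof (intro always_eventually allI continuous_on_sum)
      fix i
      have "continuous_on {0..1} (variation i)"
        using DERIV_continuous[OF variation_deriv] by (simp add: continuous_on_eq_continuous_within)
      then show "continuous_on {0..1} (\<lambda>x. a x i)"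
        unfolding a_def using \<open>0 < \<mu>\<close> by (intro continuous_intros) auto
    qed
    show "uniform_limit {0..1} (\<lambda>n x. \<Sum>i<n. a x i) h sequentially"
      unfolding h_def using a_bound sum_a[of 1] by (intro Weierstrass_m_test[where M = "a 1"]) auto
  qed simp
  \<comment> \<open>The summand for \<open>n = 0\<close> is the identity and the others are
    nondecreasing. Thus \<open>h\<close> is strictly increasing even on intervals where
    \<open>g\<close> is constant.\<close>
  have h_incr: "y - x \<le> h y - h x" if "0 \<le> x" "x \<le> y" "y \<le> 1" for x y
  proof -
    have "h y - h x = (\<Sum>n. a y n - a x n)"
      unfolding h_def using that by (intro suminf_diff sum_a) auto
    moreover have "(\<Sum>n\<in>{0}. a y n - a x n) \<le> (\<Sum>n. a y n - a x n)"
      using that variation_mono[OF that] \<open>0 < \<mu>\<close>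
      by (intro sum_le_suminf summable_diff sum_a) (auto simp: a_def intro!: divide_right_mono)
    ultimately show ?thesis using that by (simp add: a_def variation_zeroth)
  qed
  have h_image: "\<bar>h (g y) - h (g x)\<bar> \<le> \<mu> * (h y - h x)" if xy: "0 \<le> x" "x \<le> y" "y \<le> 1" for x y
  proof -
    have s_img: "summable (\<lambda>n. a (g y) n - a (g x) n)" by (intro summable_diff sum_a range)
    have s_xy: "summable (\<lambda>n. a y n - a x n)" using xy by (intro summable_diff sum_a) auto
    then have s_Suc: "summable (\<lambda>n. a y (Suc n) - a x (Suc n))"
      by (subst summable_Suc_iff[of "\<lambda>n. a y n - a x n"])
    have le: "\<bar>a (g y) n - a (g x) n\<bar> \<le> \<mu> * (a y (Suc n) - a x (Suc n))" for n
    proof -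
      have "\<bar>a (g y) n - a (g x) n\<bar> = \<bar>variation n (g y) - variation n (g x)\<bar> / \<mu> ^ n"
        using \<open>0 < \<mu>\<close> by (simp add: a_def flip: diff_divide_distrib)
      also have "\<dots> \<le> (variation (Suc n) y - variation (Suc n) x) / \<mu> ^ n"
        using variation_image[OF xy] \<open>0 < \<mu>\<close> by (intro divide_right_mono) auto
      also have "\<dots> = \<mu> * (a y (Suc n) - a x (Suc n))"
        using \<open>0 < \<mu>\<close> by (simp add: a_def field_simps)
      finally show ?thesis .
    qed
    have s_abs: "summable (\<lambda>n. \<bar>a (g y) n - a (g x) n\<bar>)"
      by (rule summable_comparison_test'[OF summable_mult[OF s_Suc, of \<mu>]]) (use le in simp)
    have "\<bar>h (g y) - h (g x)\<bar> = \<bar>\<Sum>n. a (g y) n - a (g x) n\<bar>"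
      unfolding h_def by (subst suminf_diff) (auto intro: sum_a range)
    also have "\<dots> \<le> (\<Sum>n. \<bar>a (g y) n - a (g x) n\<bar>)" by (rule summable_rabs[OF s_abs])
    also have "\<dots> \<le> (\<Sum>n. \<mu> * (a y (Suc n) - a x (Suc n)))"
      by (intro suminf_le le s_abs summable_mult s_Suc)
    also have "\<dots> = \<mu> * (\<Sum>n. a y (Suc n) - a x (Suc n))" by (rule suminf_mult[OF s_Suc])
    also have "(\<Sum>n. a y (Suc n) - a x (Suc n)) = (\<Sum>n. a y n - a x n) - (a y 0 - a x 0)"
      by (rule suminf_split_head[OF s_xy])
    also have "(\<Sum>n. a y n - a x n) = h y - h x"
      unfolding h_def using xy by (intro suminf_diff[symmetric] sum_a) auto
    \<comment> \<open>The head that the shift drops is nonnegative.\<close>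
    also have "\<mu> * ((h y - h x) - (a y 0 - a x 0)) \<le> \<mu> * (h y - h x)"
      using \<open>0 < \<mu>\<close> variation_mono[OF xy, of 0] by (intro mult_left_mono) (auto simp: a_def)
    finally show ?thesis .
  qed
  have "h 0 = 0" by (simp add: h_def a_def[abs_def])
  have "0 < h 1" using h_incr[of 0 1] \<open>h 0 = 0\<close> by simp
  define \<psi> where "\<psi> x = h x / h 1" for x
  have cont_\<psi>: "continuous_on {0..1} \<psi>"
    unfolding \<psi>_def using \<open>0 < h 1\<close> by (intro continuous_intros cont_h) auto
  have \<psi>_less: "\<psi> x < \<psi> y" if "0 \<le> x" "x < y" "y \<le> 1" for x y
    using h_incr[of x y] that \<open>0 < h 1\<close> by (simp add: \<psi>_def divide_strict_right_mono)
  have \<psi>01: "\<psi> 0 = 0" "\<psi> 1 = 1" using \<open>h 0 = 0\<close> \<open>0 < h 1\<close> by (auto simp: \<psi>_def)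
  have "\<psi> ` {0..1} = {0..1}"
  proof
    show "\<psi> ` {0..1} \<subseteq> {0..1}"
    proof
      fix u assume "u \<in> \<psi> ` {0..1}"
      then obtain x where x: "x \<in> {0..1}" "u = \<psi> x" by blast
      then have "\<psi> 0 \<le> \<psi> x" "\<psi> x \<le> \<psi> 1"
        using \<psi>_less[of 0 x] \<psi>_less[of x 1] by (cases "x = 0"; cases "x = 1"; force)+
      then show "u \<in> {0..1}" using x \<psi>01 by simp
    qed
    show "{0..1} \<subseteq> \<psi> ` {0..1}"
    proof
      fix u :: real assume "u \<in> {0..1}"
      then show "u \<in> \<psi> ` {0..1}"
        using IVT'[of \<psi> 0 u 1] cont_\<psi> \<psi>01 by auto
    qed
  qed
  moreover have "inj_on \<psi> {0..1}"
    using \<psi>_less by (intro linorder_inj_onI) fastforce+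
  ultimately obtain \<psi>' where \<psi>': "homeomorphism {0..1} {0..1} \<psi> \<psi>'"
    using homeomorphism_compact[OF compact_Icc cont_\<psi>] by blast
  have \<psi>_image: "\<bar>\<psi> (g y) - \<psi> (g x)\<bar> \<le> \<mu> * \<bar>\<psi> y - \<psi> x\<bar>" if "x \<in> {0..1}" "y \<in> {0..1}" for x y
  proof -
    have *: "\<bar>\<psi> (g y) - \<psi> (g x)\<bar> \<le> \<mu> * \<bar>\<psi> y - \<psi> x\<bar>" if xy: "0 \<le> x" "x \<le> y" "y \<le> 1" for x y
    proof -
      have "\<bar>\<psi> (g y) - \<psi> (g x)\<bar> = \<bar>h (g y) - h (g x)\<bar> / h 1"
        using \<open>0 < h 1\<close> by (simp add: \<psi>_def flip: diff_divide_distrib)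
      also have "\<dots> \<le> \<mu> * (h y - h x) / h 1"
        using h_image[OF xy] \<open>0 < h 1\<close> by (intro divide_right_mono) auto
      also have "\<dots> = \<mu> * (\<psi> y - \<psi> x)" by (simp add: \<psi>_def flip: diff_divide_distrib)
      also have "\<dots> \<le> \<mu> * \<bar>\<psi> y - \<psi> x\<bar>" using \<open>0 < \<mu>\<close> by (intro mult_left_mono) auto
      finally show ?thesis .
    qed
    show ?thesis using *[of x y] *[of y x] that by (cases x y rule: linorder_cases) (auto simp: abs_minus_commute)
  qed
  have "\<mu>-lipschitz_on {0..1} (\<psi> \<circ> g \<circ> \<psi>')"
  proof (rule lipschitz_onI)
    fix u v :: real assume uv: "u \<in> {0..1}" "v \<in> {0..1}"
    have "\<psi>' u \<in> {0..1}" "\<psi>' v \<in> {0..1}" "\<psi> (\<psi>' u) = u" "\<psi> (\<psi>' v) = v"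
      using homeomorphism_image2[OF \<psi>'] homeomorphism_apply2[OF \<psi>'] uv by blast+
    then show "dist ((\<psi> \<circ> g \<circ> \<psi>') u) ((\<psi> \<circ> g \<circ> \<psi>') v) \<le> \<mu> * dist u v"
      using \<psi>_image[of "\<psi>' v" "\<psi>' u"] by (simp add: dist_real_def)
  qed (use \<open>0 < \<mu>\<close> in simp)
  with \<psi>' show thesis by (rule that)
qed

end

subsection \<open>Entropy of conjugates of Lipschitz maps\<close>

text \<open>Agreement and invariance need each other in the induction. With \<open>g = f\<close> the
  lemma provides the invariance of \<open>X\<close> under iterates.\<close>

lemma funpow_cong_on:
  assumes "\<And>x. x \<in> X \<Longrightarrow> f x = g x" "f ` X \<subseteq> X" "x \<in> X"
  shows "(f ^^ n) x = (g ^^ n) x \<and> (f ^^ n) x \<in> X"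
  using assms by (induction n) auto

lemma topological_entropy_cong:
  assumes "\<And>x. x \<in> X \<Longrightarrow> f x = g x" "f ` X \<subseteq> X"
  shows "topological_entropy X f = topological_entropy X g"
proof -
  have "dyn_separated f n \<epsilon> E \<longleftrightarrow> dyn_separated g n \<epsilon> E" if "E \<subseteq> X" for n \<epsilon> E
  proof -
    have "(f ^^ k) x = (g ^^ k) x" if "x \<in> E" for k x
      using funpow_cong_on[OF assms] that \<open>E \<subseteq> X\<close> by blast
    then show ?thesis unfolding dyn_separated_def by simp
  qed
  then have "{E. E \<subseteq> X \<and> finite E \<and> E \<noteq> {} \<and> dyn_separated f n \<epsilon> E}
    = {E. E \<subseteq> X \<and> finite E \<and> E \<noteq> {} \<and> dyn_separated g n \<epsilon> E}" for n \<epsilon>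
    by blast
  then show ?thesis unfolding topological_entropy_def by simp
qed

text \<open>A single point is separated at all times and contributes
  \<open>ln 1 = 0\<close>.\<close>

lemma topological_entropy_nonneg:
  assumes "X \<noteq> {}"
  shows "0 \<le> topological_entropy X f"
proof -
  obtain x where x: "x \<in> X" using assms by blast
  define s where "s n = (SUP E\<in>{E. E \<subseteq> X \<and> finite E \<and> E \<noteq> {} \<and> dyn_separated f n 1 E}.
         ereal (ln (real (card E)) / real n))" for n
  have "0 \<le> s n" for n
    unfolding s_def using x by (intro SUP_upper2[of "{x}"]) (auto simp: dyn_separated_def)
  then have "0 \<le> limsup s" by (intro le_Limsup) auto
  also have "\<dots> \<le> topological_entropy X f"
    unfolding topological_entropy_def s_def by (intro SUP_upper) auto
  finally show ?thesis .
qed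

text \<open>Pigeonhole: each half-open cell of length \<eta> contains at most one point of
  \<open>S\<close>.\<close>

lemma card_spaced_le:
  fixes S :: "real set"
  assumes "S \<subseteq> {0..1}" "0 < \<eta>" and far: "\<And>x y. x \<in> S \<Longrightarrow> y \<in> S \<Longrightarrow> x \<noteq> y \<Longrightarrow> \<eta> \<le> \<bar>x - y\<bar>"
  shows "real (card S) \<le> 1 / \<eta> + 1"
proof -
  define F where "F x = nat \<lfloor>x / \<eta>\<rfloor>" for x
  have "inj_on F S"
  proof (rule inj_onI, rule ccontr)
    fix x y assume xy: "x \<in> S" "y \<in> S" "F x = F y" "x \<noteq> y"
    then have "0 \<le> x / \<eta>" "0 \<le> y / \<eta>" using assms(1,2) by auto
    then have "\<lfloor>x / \<eta>\<rfloor> = \<lfloor>y / \<eta>\<rfloor>" using xy(3) by (simp add: F_def eq_nat_nat_iff)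
    then have "\<bar>x / \<eta> - y / \<eta>\<bar> < 1" by linarith
    then have "\<bar>x - y\<bar> < \<eta>" using \<open>0 < \<eta>\<close> by (simp add: abs_less_iff field_simps)
    then show False using far[OF xy(1,2,4)] by simp
  qed
  moreover have "F ` S \<subseteq> {..nat \<lfloor>1 / \<eta>\<rfloor>}"
    using assms(1,2) by (auto simp: F_def intro!: nat_mono floor_mono divide_right_mono)
  ultimately have "card S \<le> card {..nat \<lfloor>1 / \<eta>\<rfloor>}" by (intro card_inj_on_le) auto
  then have "card S \<le> nat \<lfloor>1 / \<eta>\<rfloor> + 1" by simp
  moreover have "0 \<le> 1 / \<eta>" using \<open>0 < \<eta>\<close> by simp
  ultimately show ?thesis by linarith
qed

lemma funpow_lipschitz:
  fixes g :: "real \<Rightarrow> real"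
  assumes "L-lipschitz_on S g" "g ` S \<subseteq> S" "u \<in> S" "v \<in> S"
  shows "\<bar>(g ^^ k) u - (g ^^ k) v\<bar> \<le> L ^ k * \<bar>u - v\<bar>"
proof (induction k)
  case (Suc k)
  have "(g ^^ k) u \<in> S" "(g ^^ k) v \<in> S"
    using funpow_cong_on[of S g g _ k] assms by auto
  then have "\<bar>(g ^^ Suc k) u - (g ^^ Suc k) v\<bar> \<le> L * \<bar>(g ^^ k) u - (g ^^ k) v\<bar>"
    using lipschitz_onD[OF assms(1)] by (simp add: dist_real_def)
  also have "\<dots> \<le> L * (L ^ k * \<bar>u - v\<bar>)"
    using lipschitz_on_nonneg[OF assms(1)] by (intro mult_left_mono Suc)
  finally show ?case by (simp add: mult_ac)
qed simp

lemma homeomorphism_funpow: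
  assumes "homeomorphism X Y \<psi> \<psi>'" "f ` X \<subseteq> X" "x \<in> X"
  shows "((\<psi> \<circ> f \<circ> \<psi>') ^^ n) (\<psi> x) = \<psi> ((f ^^ n) x)"
proof (induction n)
  case (Suc n)
  have "(f ^^ n) x \<in> X" using funpow_cong_on[of X f f x n] assms by auto
  then show ?case using Suc homeomorphism_apply1[OF assms(1)] by simp
qed simp

text \<open>If \<open>L < 1\<close>, the iterates of the conjugate contract everything to a fixed
  point, so the intersection of the images is this one point.\<close>

lemma Lipschitz_conjugate_ge_1:
  fixes f \<psi> \<psi>' :: "real \<Rightarrow> real"
  assumes "continuous_on {0..1} f" and f: "f ` {0..1} \<subseteq> {0..1}"
    and nonsing: "\<not> is_singleton (\<Inter>i. (f ^^ i) ` {0..1})"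
    and \<psi>: "homeomorphism {0..1} {0..1} \<psi> \<psi>'" and L: "L-lipschitz_on {0..1} (\<psi> \<circ> f \<circ> \<psi>')"
  shows "1 \<le> L"
proof (rule ccontr)
  assume "\<not> 1 \<le> L"
  then have "0 \<le> L" "L < 1" using lipschitz_on_nonneg[OF L] by auto
  let ?g = "\<psi> \<circ> f \<circ> \<psi>'"
  have g: "?g ` {0..1} \<subseteq> {0..1}"
    using homeomorphism_image1[OF \<psi>] homeomorphism_image2[OF \<psi>] f unfolding image_comp[symmetric] by blast
  \<comment> \<open>A fixed point lies in every image, so the intersection is nonempty.\<close>
  obtain p where p: "p \<in> {0..1}" "f p = p"
    using brouwer[of "{0..1}" f] assms(1) f by (auto simp: image_subset_iff_funcset)
  have "(f ^^ i) p = p" for i using p by (induction i) auto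
  then have "p \<in> (\<Inter>i. (f ^^ i) ` {0..1})" using p(1) by (metis INT_I imageI)
  moreover have uniq: "q = p" if q: "q \<in> (\<Inter>i. (f ^^ i) ` {0..1})" for q
  proof -
    have "q \<in> (f ^^ 0) ` {0..1}" using q by blast
    then have q01: "q \<in> {0..1}" by simp
    have le: "\<bar>\<psi> q - \<psi> p\<bar> \<le> L ^ i" for i
    proof -
      have "q \<in> (f ^^ i) ` {0..1}" using q by simp
      then obtain x where x: "x \<in> {0..1}" "(f ^^ i) x = q" by auto
      have "\<psi> x \<in> {0..1}" "\<psi> p \<in> {0..1}" using homeomorphism_image1[OF \<psi>] x(1) p(1) by blast+
      have "\<bar>\<psi> q - \<psi> p\<bar> = \<bar>(?g ^^ i) (\<psi> x) - (?g ^^ i) (\<psi> p)\<bar>"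
        using homeomorphism_funpow[OF \<psi> f] x p(1) \<open>(f ^^ i) p = p\<close> by simp
      also have "\<dots> \<le> L ^ i * \<bar>\<psi> x - \<psi> p\<bar>"
        by (intro funpow_lipschitz[OF L g]) fact+
      also have "\<dots> \<le> L ^ i * 1"
        using \<open>\<psi> x \<in> _\<close> \<open>\<psi> p \<in> _\<close> \<open>0 \<le> L\<close> by (intro mult_left_mono) auto
      finally show ?thesis by simp
    qed
    have "(\<lambda>i. L ^ i) \<longlonglongrightarrow> 0" using \<open>0 \<le> L\<close> \<open>L < 1\<close> by (intro LIMSEQ_realpow_zero)
    then have "\<bar>\<psi> q - \<psi> p\<bar> \<le> 0" by (rule LIMSEQ_le_const) (use le in blast)
    then have "\<psi>' (\<psi> q) = \<psi>' (\<psi> p)" by simp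
    then show ?thesis unfolding homeomorphism_apply1[OF \<psi> q01] homeomorphism_apply1[OF \<psi> p(1)] .
  qed
  ultimately have "is_singleton (\<Inter>i. (f ^^ i) ` {0..1})"
  proof (intro is_singletonI')
    fix q q' assume "q \<in> (\<Inter>i. (f ^^ i) ` {0..1})" "q' \<in> (\<Inter>i. (f ^^ i) ` {0..1})"
    from this[THEN uniq] show "q = q'" by simp
  qed (rule ex_in_conv[THEN iffD1], rule exI)
  then show False using nonsing by contradiction
qed

text \<open>By uniform continuity of \<psi>', orbits that are \<epsilon> apart under
  \<open>f\<close> at a time \<open>k < n\<close> are \<delta> apart after conjugation, so their
  starting points are at least \<open>\<delta> / L ^ n\<close> apart. This leaves room for at most
  \<open>C * L ^ n\<close> points, and \<open>ln C / n\<close> vanishes in the limit.\<close>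

lemma topological_entropy_le_ln_Lipschitz:
  fixes f \<psi> \<psi>' :: "real \<Rightarrow> real"
  assumes f: "f ` {0..1} \<subseteq> {0..1}" and \<psi>: "homeomorphism {0..1} {0..1} \<psi> \<psi>'"
    and L: "L-lipschitz_on {0..1} (\<psi> \<circ> f \<circ> \<psi>')" and "1 \<le> L"
  shows "topological_entropy {0..1} f \<le> ereal (ln L)"
  unfolding topological_entropy_def
proof (rule SUP_least)
  fix \<epsilon> :: real assume "\<epsilon> \<in> {0<..}"
  then have "0 < \<epsilon>" by simp
  let ?g = "\<psi> \<circ> f \<circ> \<psi>'"
  have g: "?g ` {0..1} \<subseteq> {0..1}"
    using homeomorphism_image1[OF \<psi>] homeomorphism_image2[OF \<psi>] f unfolding image_comp[symmetric] by blast
  have \<psi>01: "\<psi> x \<in> {0..1}" if "x \<in> {0..1}" for x using homeomorphism_image1[OF \<psi>] that by blast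
  have "uniformly_continuous_on {0..1} \<psi>'"
    using homeomorphism_cont2[OF \<psi>] by (intro compact_uniformly_continuous) auto
  then obtain \<delta> where "0 < \<delta>" and \<delta>: "\<And>u v. u \<in> {0..1} \<Longrightarrow> v \<in> {0..1} \<Longrightarrow> \<bar>u - v\<bar> < \<delta> \<Longrightarrow> \<bar>\<psi>' u - \<psi>' v\<bar> < \<epsilon>"
    using \<open>0 < \<epsilon>\<close> unfolding uniformly_continuous_on_def dist_real_def by metis
  define C where "C = 1 / \<delta> + 1"
  have "1 \<le> C" using \<open>0 < \<delta>\<close> by (simp add: C_def)
  have card_le: "real (card E) \<le> C * L ^ n" if E: "E \<subseteq> {0..1}" "dyn_separated f n \<epsilon> E" for E n
  proof -
    have inj: "inj_on \<psi> E" using E(1) homeomorphism_apply1[OF \<psi>] by (metis inj_on_def subsetD)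
    have "real (card (\<psi> ` E)) \<le> 1 / (\<delta> / L ^ n) + 1"
    proof (rule card_spaced_le)
      show "\<psi> ` E \<subseteq> {0..1}" using E(1) \<psi>01 by blast
      show "0 < \<delta> / L ^ n" using \<open>0 < \<delta>\<close> \<open>1 \<le> L\<close> by simp
      fix u v assume "u \<in> \<psi> ` E" "v \<in> \<psi> ` E" "u \<noteq> v"
      then obtain x y where xy: "x \<in> E" "y \<in> E" "u = \<psi> x" "v = \<psi> y" "x \<noteq> y" by blast
      then obtain k where k: "k < n" "\<epsilon> < \<bar>(f ^^ k) x - (f ^^ k) y\<bar>"
        using E(2) unfolding dyn_separated_def dist_real_def by blast
      have x01: "x \<in> {0..1}" "y \<in> {0..1}" using xy E(1) by auto
      then have fk: "(f ^^ k) x \<in> {0..1}" "(f ^^ k) y \<in> {0..1}"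
        using funpow_cong_on[of "{0..1}" f f _ k] f by blast+
      have "\<delta> \<le> \<bar>\<psi> ((f ^^ k) x) - \<psi> ((f ^^ k) y)\<bar>"
        using \<delta>[OF \<psi>01[OF fk(1)] \<psi>01[OF fk(2)]] k(2) homeomorphism_apply1[OF \<psi>] fk by force
      also have "\<dots> = \<bar>(?g ^^ k) u - (?g ^^ k) v\<bar>"
        using homeomorphism_funpow[OF \<psi> f] x01 xy by simp
      also have "\<dots> \<le> L ^ k * \<bar>u - v\<bar>"
        using xy x01 \<psi>01 by (intro funpow_lipschitz[OF L g]) auto
      also have "\<dots> \<le> L ^ n * \<bar>u - v\<bar>"
        using k(1) \<open>1 \<le> L\<close> by (intro mult_right_mono power_increasing) auto
      finally show "\<delta> / L ^ n \<le> \<bar>u - v\<bar>" using \<open>1 \<le> L\<close> by (simp add: divide_le_eq mult.commute)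
    qed
    \<comment> \<open>Since \<open>1 \<le> L ^ n\<close>, the additive 1 in the count is absorbed
      into \<open>C * L ^ n\<close>.\<close>
    moreover have "1 \<le> L ^ n" using \<open>1 \<le> L\<close> by simp
    ultimately show ?thesis using card_image[OF inj] by (simp add: C_def algebra_simps)
  qed
  have "limsup (\<lambda>n. SUP E\<in>{E. E \<subseteq> {0..1} \<and> finite E \<and> E \<noteq> {} \<and> dyn_separated f n \<epsilon> E}.
          ereal (ln (real (card E)) / real n)) \<le> limsup (\<lambda>n. ereal (ln C / real n + ln L))"
  proof (rule Limsup_mono)
    show "\<forall>\<^sub>F n in sequentially. (SUP E\<in>{E. E \<subseteq> {0..1} \<and> finite E \<and> E \<noteq> {} \<and> dyn_separated f n \<epsilon> E}.
          ereal (ln (real (card E)) / real n)) \<le> ereal (ln C / real n + ln L)"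
      using eventually_gt_at_top[of "0::nat"]
    proof eventually_elim
      case (elim n)
      show ?case
      proof (rule SUP_least)
        fix E assume "E \<in> {E. E \<subseteq> {0..1} \<and> finite E \<and> E \<noteq> {} \<and> dyn_separated f n \<epsilon> E}"
        then have "real (card E) \<le> C * L ^ n" "0 < card E" using card_le by (auto simp: card_gt_0_iff)
        then have "ln (real (card E)) \<le> ln (C * L ^ n)" by (intro ln_mono) auto
        also have "\<dots> = ln C + real n * ln L"
          using \<open>1 \<le> C\<close> \<open>1 \<le> L\<close> by (simp add: ln_mult ln_realpow)
        finally show "ereal (ln (real (card E)) / real n) \<le> ereal (ln C / real n + ln L)"
          using elim by (simp add: field_simps)
      qed
    qed
  qed
  also have "\<dots> = ereal (ln L)"
  proof (rule lim_imp_Limsup)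
    have "(\<lambda>n. ln C / real n + ln L) \<longlonglongrightarrow> 0 + ln L" by (intro tendsto_intros lim_const_over_n)
    then show "(\<lambda>n. ereal (ln C / real n + ln L)) \<longlonglongrightarrow> ereal (ln L)" by simp
  qed simp
  finally show "limsup (\<lambda>n. SUP E\<in>{E. E \<subseteq> {0..1} \<and> finite E \<and> E \<noteq> {} \<and> dyn_separated f n \<epsilon> E}.
          ereal (ln (real (card E)) / real n)) \<le> ereal (ln L)" .
qed

section \<open>The upper bound for \<open>Lip_inf\<close> and the equality\<close>

lemma ereal_exp_mono: "x \<le> y \<Longrightarrow> ereal_exp x \<le> ereal_exp y"
  by (cases x; cases y) (auto simp: ereal_exp_def)

lemma Lip_inf_le:
  fixes f :: "real \<Rightarrow> real"
  assumes f: "f ` {0..1} \<subseteq> {0..1}" and smooth: "C_infinity_on f {0..1}"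
    and ent: "topological_entropy {0..1} f < ereal c" and "0 \<le> c" "exp c < \<mu>"
  shows "Lip_inf f \<le> ereal \<mu>"
proof -
  \<comment> \<open>The retraction of the line onto the unit interval extends \<open>f\<close> and
    \<open>f'\<close> by constants. Neither the entropy nor the conjugates on the interval notice
    the change.\<close>
  define clamp where "clamp x = max 0 (min 1 x)" for x :: real
  have clamp: "clamp x \<in> {0..1}" "x \<in> {0..1} \<Longrightarrow> clamp x = x" for x
    by (auto simp: clamp_def)
  have cont_clamp: "continuous_on UNIV clamp"
    unfolding clamp_def by (intro continuous_intros)
  have C_k: "C_k_on k f {0..1}" for k using smooth by (simp add: C_infinity_on_def)
  from C_k[of "Suc 0"] obtain f' where f': "\<And>x. x \<in> {0..1} \<Longrightarrow> (f has_real_derivative f' x) (at x within {0..1})"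
    by (metis C_k_on.simps(2))
  have C_k': "C_k_on k f' {0..1}" for k
    using C_infinity_on_derivative[OF smooth _ f'] by simp
  define g where "g x = f (clamp x)" for x
  define g' where "g' x = f' (clamp x)" for x
  have g_eq: "f x = g x" "f' x = g' x" if "x \<in> {0..1}" for x
    using that clamp(2) by (auto simp: g_def g'_def)
  have C_k_g: "C_k_on k g {0..1}" "C_k_on k g' {0..1}" for k
    using C_k_on_cong[OF C_k g_eq(1)] C_k_on_cong[OF C_k' g_eq(2)] by auto
  interpret unit_interval_C1_map g g'
  proof
    show "continuous_on UNIV g" "continuous_on UNIV g'"
      unfolding g_def g'_def
      using continuous_on_compose2[OF C_k_on_imp_continuous[OF C_k[of 0]] cont_clamp]
        continuous_on_compose2[OF C_k_on_imp_continuous[OF C_k'[of 0]] cont_clamp]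
        image_subsetI[of UNIV clamp "{0..1}"] clamp(1) by blast+
    show "g x \<in> {0..1}" for x using f clamp(1) unfolding g_def by blast
    show "(g has_real_derivative g' x) (at x within {0..1})" if "x \<in> {0..1}" for x
      using has_field_derivative_transform_within[OF f'[OF that] zero_less_one that, of g] g_eq that by simp
  qed
  have "topological_entropy {0..1} g < ereal c"
    using ent topological_entropy_cong[OF g_eq(1) f] by simp
  then have summable: "summable (\<lambda>n. variation n 1 / \<mu> ^ n)"
    using summable_integral_chain_deriv[OF C_k_g _ \<open>0 \<le> c\<close> \<open>exp c < \<mu>\<close>] by (simp add: variation_def)
  have "0 < \<mu>" using \<open>exp c < \<mu>\<close> exp_gt_zero[of c] by linarith
  obtain \<psi> \<psi>' :: "real \<Rightarrow> real" where \<psi>: "homeomorphism {0..1} {0..1} \<psi> \<psi>'" "\<mu>-lipschitz_on {0..1} (\<psi> \<circ> g \<circ> \<psi>')"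
    using Lipschitz_conjugacy[OF \<open>0 < \<mu>\<close> summable] .
  have "\<mu>-lipschitz_on {0..1} (\<psi> \<circ> f \<circ> \<psi>')"
  proof (rule lipschitz_on_transform[OF \<psi>(2)])
    fix x :: real assume "x \<in> {0..1}"
    then have "\<psi>' x \<in> {0..1}" using homeomorphism_image2[OF \<psi>(1)] by blast
    then show "(\<psi> \<circ> f \<circ> \<psi>') x = (\<psi> \<circ> g \<circ> \<psi>') x" using g_eq(1) by simp
  qed
  then show ?thesis unfolding Lip_inf_def using \<psi>(1) by (intro Inf_lower) blast
qed

theorem corollary3p6:
  fixes f :: "real \<Rightarrow> real"
  assumes "continuous_on {0..1} f"
    and "f ` {0..1} \<subseteq> {0..1}"
    and "\<not> is_singleton (\<Inter>i. (f ^^ i) ` {0..1})"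
    and "C_infinity_on f {0..1}"
  shows "Lip_inf f = ereal_exp (topological_entropy {0..1} f)"
proof (rule antisym)
  show "ereal_exp (topological_entropy {0..1} f) \<le> Lip_inf f"
    unfolding Lip_inf_def
  proof (rule Inf_greatest)
    fix z assume "z \<in> {ereal L | (L :: real) (\<psi> :: real \<Rightarrow> real) (\<psi>' :: real \<Rightarrow> real). homeomorphism {0..1} {0..1} \<psi> \<psi>' \<and> L-lipschitz_on {0..1} (\<psi> \<circ> f \<circ> \<psi>')}"
    then obtain L and \<psi> \<psi>' :: "real \<Rightarrow> real" where z: "z = ereal L"
      and \<psi>: "homeomorphism {0..1} {0..1} \<psi> \<psi>'" and L: "L-lipschitz_on {0..1} (\<psi> \<circ> f \<circ> \<psi>')" by blast
    \<comment> \<open>Here the hypothesis on the intersection enters: the entropy is nonnegative, so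
      its exponential could not lie below a constant \<open>L < 1\<close>.\<close>
    have "1 \<le> L" by (rule Lipschitz_conjugate_ge_1[OF assms(1-3) \<psi> L])
    then have "ereal_exp (topological_entropy {0..1} f) \<le> ereal_exp (ereal (ln L))"
      by (intro ereal_exp_mono topological_entropy_le_ln_Lipschitz[OF assms(2) \<psi> L])
    then show "ereal_exp (topological_entropy {0..1} f) \<le> z"
      using \<open>1 \<le> L\<close> by (simp add: ereal_exp_def z)
  qed
  show "Lip_inf f \<le> ereal_exp (topological_entropy {0..1} f)"
  proof (cases "topological_entropy {0..1} f")
    case (real h)
    then have "0 \<le> h" using topological_entropy_nonneg[of "{0..1::real}" f] by simp
    have "Lip_inf f \<le> ereal (exp h) + ereal e" if "0 < e" for e
    proof -
      have "0 < exp h + e" using that by (simp add: add_pos_pos)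
      have "ln (exp h) < ln (exp h + e)" using that by (intro ln_less_cancel_iff[THEN iffD2]) (auto intro: add_pos_pos)
      \<comment> \<open>An intermediate \<open>c\<close> separates the two strict inequalities,
        entropy below \<open>c\<close> and \<open>exp c\<close> below the Lipschitz
        constant.\<close>
      then obtain c where c: "h < c" "c < ln (exp h + e)" using dense by auto
      have "exp c < exp (ln (exp h + e))" using c(2) by simp
      then have "exp c < exp h + e" using \<open>0 < exp h + e\<close> by simp
      then have "Lip_inf f \<le> ereal (exp h + e)"
        using real c(1) \<open>0 \<le> h\<close> by (intro Lip_inf_le[OF assms(2,4), of c]) auto
      then show ?thesis by simp
    qed
    then have "Lip_inf f \<le> ereal (exp h)" by (rule ereal_le_epsilon2)
    then show ?thesis by (simp add: real ereal_exp_def)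
  next
    case MInf
    then show ?thesis using topological_entropy_nonneg[of "{0..1::real}" f] by simp
  \<comment> \<open>If the entropy is infinite, so is the right-hand side.\<close>
  qed (simp add: ereal_exp_def)
qed

end
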